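(* For any classical-quantum channel $W:\mathcal{X}\to\mathcal{S}(\mathcal{H})$ with $\mathcal{X}$ finite and $\mathcal{H}$ finite-dimensional, $R(W)\le C(W)$, where $C(W):=\sup_{p\in\mathcal{P}(\mathcal{X})}I(X;B)_{W\times p}$.
   Context: $\mathcal{S}(\mathcal{H})$ is the set of density matrices on $\mathcal{H}$, $\mathcal{P}(\mathcal{X})$ the set of probability distributions on $\mathcal{X}$. For $p\in\mathcal{P}(\mathcal{X})$, $W(p)=\sum_xp(x)W_x$ and $I(X;B)_{W\times p}=\sum_xp(x)D(W_x\|W(p))$ with $D(\rho\|\sigma)=\mathrm{Tr}\,\rho(\log\rho-\log\sigma)$, logarithms base 2. For $x^n\in\mathcal{X}^n$, $W^{\otimes n}_{x^n}=W_{x_1}\otimes\cdots\otimes W_{x_n}$ and for a distribution $p^n$ on $\mathcal{X}^n$, $W^{\otimes n}(p^n)=\sum_{x^n}p^n(x^n)W^{\otimes n}_{x^n}$. $\mathcal{P}_M(\mathcal{X}^n)$ is the set of distributions $q$ on $\mathcal{X}^n$ with $Mq(x^n)\in\mathbb{Z}$ for all $x^n$. $\varepsilon(W^{\otimes n},M):=\sup_{p^n\in\mathcal{P}(\mathcal{X}^n)}\inf_{q^n\in\mathcal{P}_M(\mathcal{X}^n)}\frac12\|W^{\otimes n}(p^n)-W^{\otimes n}(q^n)\|_1$, and $R(W):=\inf\{R>0:\ \forall\gamma>0,\ \liminf_{n\to\infty}\varepsilon(W^{\otimes n},\lfloor2^{n(R+\gamma)}\rfloor)=0\}$. *)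

theory Defs
  imports "Jordan_Normal_Form.Spectral_Radius" "Jordan_Normal_Form.Schur_Decomposition"
    "HOL-Library.Extended_Real" "HOL-Library.Liminf_Limsup"
begin

definition mtrace :: "complex mat \<Rightarrow> complex" where
  "mtrace A = (\<Sum>i<dim_row A. A $$ (i, i))"

definition kron :: "complex mat \<Rightarrow> complex mat \<Rightarrow> complex mat" where
  "kron A B = mat (dim_row A * dim_row B) (dim_col A * dim_col B)
     (\<lambda>(i, j). A $$ (i div dim_row B, j div dim_col B) * B $$ (i mod dim_row B, j mod dim_col B))"

definition tensor_list :: "complex mat list \<Rightarrow> complex mat" where
  "tensor_list As = foldr kron As (1\<^sub>m 1)"

definition hermitian :: "complex mat \<Rightarrow> bool" where
  "hermitian A \<longleftrightarrow> square_mat A \<and> mat_adjoint A = A"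

definition psd :: "complex mat \<Rightarrow> bool" where
  "psd A \<longleftrightarrow> hermitian A \<and>
     (\<forall>v \<in> carrier_vec (dim_row A). 0 \<le> Re (conjugate v \<bullet> (A *\<^sub>v v)))"

definition density :: "nat \<Rightarrow> complex mat \<Rightarrow> bool" where
  "density d \<rho> \<longleftrightarrow> \<rho> \<in> carrier_mat d d \<and> psd \<rho> \<and> mtrace \<rho> = 1"

definition mat_poly :: "complex poly \<Rightarrow> complex mat \<Rightarrow> complex mat" where
  "mat_poly p A = mat (dim_row A) (dim_col A)
     (\<lambda>(i, j). \<Sum>k\<le>degree p. coeff p k * (A ^\<^sub>m k) $$ (i, j))"

definition interp :: "(complex \<Rightarrow> complex) \<Rightarrow> complex set \<Rightarrow> complex poly" where
  "interp g S = (\<Sum>a\<in>S. Polynomial.smult (g a) (\<Prod>b\<in>S - {a}. Polynomial.smult (1 / (a - b)) [:- b, 1:]))"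

text \<open>f(A) = sum over the eigenvalues l of A of f(l) times the spectral projection onto
  the l-eigenspace (Lagrange--Sylvester formula); for Hermitian A this is the usual
  spectral functional calculus.\<close>
definition mat_fun :: "(real \<Rightarrow> real) \<Rightarrow> complex mat \<Rightarrow> complex mat" where
  "mat_fun f A = mat_poly (interp (\<lambda>z. complex_of_real (f (Re z))) (spectrum A)) A"

text \<open>Matrix logarithm base 2 (applied on the support; eigenvalue 0 is sent to 0).\<close>
definition mlog2 :: "complex mat \<Rightarrow> complex mat" where
  "mlog2 A = mat_fun (\<lambda>t. if 0 < t then log 2 t else 0) A"

definition trace_norm :: "complex mat \<Rightarrow> real" where
  "trace_norm A = Re (mtrace (mat_fun sqrt (mat_adjoint A * A)))"

definition rel_entropy :: "complex mat \<Rightarrow> complex mat \<Rightarrow> real" where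
  "rel_entropy \<rho> \<sigma> = Re (mtrace (\<rho> * (mlog2 \<rho> - mlog2 \<sigma>)))"

definition distr :: "'a set \<Rightarrow> ('a \<Rightarrow> real) set" where
  "distr A = {p. (\<forall>x. 0 \<le> p x) \<and> (\<forall>x. x \<notin> A \<longrightarrow> p x = 0) \<and> sum p A = 1}"

definition words :: "nat \<Rightarrow> 'x list set" where
  "words n = {xs. length xs = n}"

definition distr_M :: "nat \<Rightarrow> nat \<Rightarrow> ('x list \<Rightarrow> real) set" where
  "distr_M M n = {q \<in> distr (words n). \<forall>xs. real M * q xs \<in> \<int>}"

definition cq_out :: "nat \<Rightarrow> ('x::finite \<Rightarrow> complex mat) \<Rightarrow> ('x \<Rightarrow> real) \<Rightarrow> complex mat" where
  "cq_out d W p = mat d d (\<lambda>(i, j). \<Sum>x\<in>UNIV. complex_of_real (p x) * W x $$ (i, j))"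

definition cq_out_n :: "nat \<Rightarrow> ('x::finite \<Rightarrow> complex mat) \<Rightarrow> nat \<Rightarrow> ('x list \<Rightarrow> real) \<Rightarrow> complex mat" where
  "cq_out_n d W n p = mat (d ^ n) (d ^ n)
     (\<lambda>(i, j). \<Sum>xs\<in>words n. complex_of_real (p xs) * tensor_list (map W xs) $$ (i, j))"

definition mutual_info :: "nat \<Rightarrow> ('x::finite \<Rightarrow> complex mat) \<Rightarrow> ('x \<Rightarrow> real) \<Rightarrow> real" where
  "mutual_info d W p = (\<Sum>x\<in>UNIV. p x * rel_entropy (W x) (cq_out d W p))"

definition capacity :: "nat \<Rightarrow> ('x::finite \<Rightarrow> complex mat) \<Rightarrow> real" where
  "capacity d W = (SUP p \<in> distr UNIV. mutual_info d W p)"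

definition approx_err :: "nat \<Rightarrow> ('x::finite \<Rightarrow> complex mat) \<Rightarrow> nat \<Rightarrow> nat \<Rightarrow> real" where
  "approx_err d W n M = (SUP p \<in> distr (words n). INF q \<in> distr_M M n.
      trace_norm (cq_out_n d W n p - cq_out_n d W n q) / 2)"

definition sim_rate :: "nat \<Rightarrow> ('x::finite \<Rightarrow> complex mat) \<Rightarrow> real" where
  "sim_rate d W = Inf {R. 0 < R \<and> (\<forall>\<gamma>>0.
      liminf (\<lambda>n. ereal (approx_err d W n (nat \<lfloor>2 powr (real n * (R + \<gamma>))\<rfloor>))) = 0)}"

end

theory Submission
  imports Defs "HOL-Analysis.L2_Norm" "HOL-Real_Asymp.Real_Asymp"
begin

text \<open>
  Split the words of length \<open>n\<close> by their type \<open>P\<close>; there are only polynomially many types. For a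
  word \<open>x\<close> of type \<open>P\<close> let \<open>\<rho> = W\<^sub>x\<close> (a tensor product) and \<open>\<sigma> = W(P)\<^sup>\<otimes>\<^sup>n\<close>. By Chebyshev's inequality,
  applied to the outcome of measuring \<open>\<rho>\<close> in the product eigenbases of \<open>\<sigma>\<close> and of \<open>\<rho>\<close>, the state \<open>\<rho>\<close>
  is close in trace norm to \<open>\<rho>' = \<Pi>\<^sub>\<sigma> \<rho> \<Pi>\<^sub>\<rho>\<close> with the two typical projections, and the Hilbert--Schmidt
  norm satisfies \<open>\<parallel>\<sigma>\<^sup>-\<^sup>1\<^sup>/\<^sup>2 \<rho>'\<parallel>\<^sup>2 \<le> 2\<close> to the power \<open>n (I(P) + 2\<delta>) \<le> n (C + 2\<delta>)\<close>. Because the type is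
  used for \<open>\<sigma>\<close>, no minimax theorem is needed to bring in the capacity.

  Since \<open>|tr (S \<sigma>\<^sup>1\<^sup>/\<^sup>2 X)| \<le> \<parallel>X\<parallel>\<close> for unitary \<open>S\<close>, it remains to approximate an average of vectors
  \<open>\<sigma>\<^sup>-\<^sup>1\<^sup>/\<^sup>2 \<rho>'\<close> in a Hilbert space by an average of \<open>M\<close> of them, which Maurey's empirical method does with
  squared error at most \<open>2\<close> to the power \<open>n (C + 2\<delta>)\<close> divided by \<open>M\<close>.
\<close>

section \<open>Adjoints, unitary matrices and the spectral theorem\<close>

text \<open>Comparing the trace norm with the Hilbert-Schmidt norm on the whole space costs a factor
  \<open>sqrt (d ^ n)\<close>. Factoring out \<open>\<sigma>\<^sup>1\<^sup>/\<^sup>2\<close>, whose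
  Hilbert-Schmidt norm is 1, costs instead the ratio of the largest eigenvalue kept of \<rho> to the
  smallest one kept of \<sigma>; on the typical subspaces this ratio is about 2 to the power n I(P).
  A single \<sigma> for all words would need divergence at most C from every \<open>W x\<close>,
  which is the minimax statement. Within a type only the average of these divergences over the
  letters enters, and that average is I(P).

  Chebyshev's inequality is strong enough because no union bound over words is taken: the truncation
  errors are averaged with weights of total mass 2, whatever the input distribution is. The number
  of types multiplies only the exponentially small term.\<close>

lemma adj_dim [simp]:
  "dim_row (mat_adjoint A) = dim_col A" "dim_col (mat_adjoint A) = dim_row A"
  by (auto simp: mat_adjoint_def)

lemma adj_carrier [simp]: "A \<in> carrier_mat n m \<Longrightarrow> mat_adjoint A \<in> carrier_mat m n"
  by (rule carrier_matI) auto

lemma adj_index [simp]: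
  fixes A :: "complex mat"
  assumes "i < dim_col A" "j < dim_row A"
  shows "mat_adjoint A $$ (i, j) = cnj (A $$ (j, i))"
  using assms by (simp add: mat_adjoint_def mat_of_rows_index)

lemma mult_index:
  assumes "A \<in> carrier_mat n m" "B \<in> carrier_mat m k" "i < n" "j < k"
  shows "(A * B) $$ (i, j) = (\<Sum>l<m. A $$ (i, l) * B $$ (l, j))"
  using assms by (simp add: scalar_prod_def lessThan_atLeast0)

lemma adj_adj [simp]: "mat_adjoint (mat_adjoint A) = (A :: complex mat)"
  by (rule eq_matI) auto

lemma adj_mult:
  fixes A :: "complex mat"
  assumes A: "A \<in> carrier_mat n m" and B: "B \<in> carrier_mat m k"
  shows "mat_adjoint (A * B) = mat_adjoint B * mat_adjoint A"
proof (rule eq_matI)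
  fix i j assume "i < dim_row (mat_adjoint B * mat_adjoint A)" "j < dim_col (mat_adjoint B * mat_adjoint A)"
  hence i: "i < k" and j: "j < n" using A B by auto
  have "mat_adjoint (A * B) $$ (i, j) = cnj (\<Sum>l<m. A $$ (j, l) * B $$ (l, i))"
    using A B i j by (simp add: mult_index[OF A B, symmetric] del: index_mult_mat(1))
  also have "\<dots> = (\<Sum>l<m. mat_adjoint B $$ (i, l) * mat_adjoint A $$ (l, j))"
    unfolding cnj_sum using A B i j by (intro sum.cong) auto
  also have "\<dots> = (mat_adjoint B * mat_adjoint A) $$ (i, j)"
    by (rule mult_index[symmetric]) (use A B i j in auto)
  finally show "mat_adjoint (A * B) $$ (i, j) = (mat_adjoint B * mat_adjoint A) $$ (i, j)" .
qed (use A B in auto)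

lemma mult_square_carrier [simp]:
  "A \<in> carrier_mat n n \<Longrightarrow> B \<in> carrier_mat n n \<Longrightarrow> A * B \<in> carrier_mat n n"
  by (rule mult_carrier_mat)

definition unitary :: "nat \<Rightarrow> complex mat \<Rightarrow> bool" where
  "unitary n U \<longleftrightarrow> U \<in> carrier_mat n n \<and> mat_adjoint U * U = 1\<^sub>m n \<and> U * mat_adjoint U = 1\<^sub>m n"

lemma unitaryD:
  assumes "unitary n U"
  shows "U \<in> carrier_mat n n" "mat_adjoint U \<in> carrier_mat n n"
    "mat_adjoint U * U = 1\<^sub>m n" "U * mat_adjoint U = 1\<^sub>m n"
  using assms by (auto simp: unitary_def)

lemma unitaryI:
  assumes "U \<in> carrier_mat n n" "mat_adjoint U * U = 1\<^sub>m n"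
  shows "unitary n U"
  using assms mat_mult_left_right_inverse[of "mat_adjoint U" n U] by (simp add: unitary_def)

lemma unitary_adj: "unitary n U \<Longrightarrow> unitary n (mat_adjoint U)"
  by (simp add: unitary_def)

lemma unitary_cancel:
  assumes "unitary n U" "A \<in> carrier_mat n m"
  shows "mat_adjoint U * (U * A) = A" "U * (mat_adjoint U * A) = A"
  using assms unitaryD[OF assms(1)] by (simp_all flip: assoc_mult_mat[of _ n n _ n _ m])

lemma unitary_mult:
  assumes "unitary n U" "unitary n V" shows "unitary n (U * V)"
proof (rule unitaryI)
  note U = unitaryD[OF assms(1)] and V = unitaryD[OF assms(2)]
  show "U * V \<in> carrier_mat n n" using U V by auto
  have "mat_adjoint (U * V) * (U * V) = mat_adjoint V * (mat_adjoint U * (U * V))"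
    using U V by (simp add: adj_mult[of _ n n _ n] assoc_mult_mat[of _ n n _ n _ n])
  also have "\<dots> = 1\<^sub>m n" using unitary_cancel[OF assms(1) V(1)] V by simp
  finally show "mat_adjoint (U * V) * (U * V) = 1\<^sub>m n" .
qed

section \<open>Real diagonal matrices\<close>

definition dg :: "nat \<Rightarrow> (nat \<Rightarrow> real) \<Rightarrow> complex mat" where
  "dg n f = mat n n (\<lambda>(i, j). if i = j then complex_of_real (f i) else 0)"

lemma dg_carrier [simp]: "dg n f \<in> carrier_mat n n"
  and dg_dim [simp]: "dim_row (dg n f) = n" "dim_col (dg n f) = n"
  and dg_index [simp]: "i < n \<Longrightarrow> j < n \<Longrightarrow> dg n f $$ (i, j) = (if i = j then complex_of_real (f i) else 0)"
  by (auto simp: dg_def)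

lemma dg_cong: "(\<And>i. i < n \<Longrightarrow> f i = h i) \<Longrightarrow> dg n f = dg n h"
  by (rule eq_matI) auto

lemma adj_dg [simp]: "mat_adjoint (dg n f) = dg n f"
  by (rule eq_matI) auto

lemma dg_mult_left_index:
  assumes "A \<in> carrier_mat n m" "i < n" "j < m"
  shows "(dg n f * A) $$ (i, j) = complex_of_real (f i) * A $$ (i, j)"
proof -
  have "(dg n f * A) $$ (i, j) = (\<Sum>l<n. (if i = l then complex_of_real (f i) * A $$ (i, j) else 0))"
    unfolding mult_index[OF dg_carrier assms]
    by (rule sum.cong) (use assms in auto)
  thus ?thesis using assms by simp
qed

lemma dg_mult_right_index:
  assumes "A \<in> carrier_mat m n" "i < m" "j < n"
  shows "(A * dg n f) $$ (i, j) = A $$ (i, j) * complex_of_real (f j)"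
proof -
  have "(A * dg n f) $$ (i, j) = (\<Sum>l<n. (if l = j then A $$ (i, j) * complex_of_real (f j) else 0))"
    unfolding mult_index[OF assms(1) dg_carrier assms(2,3)]
    by (rule sum.cong) (use assms in auto)
  thus ?thesis using assms by simp
qed

lemma dg_mult_dg: "dg n f * dg n g = dg n (\<lambda>i. f i * g i)"
  by (rule eq_matI) (auto simp: dg_mult_left_index[OF dg_carrier] simp del: index_mult_mat(1))

lemma dg_mult_dg_left: "A \<in> carrier_mat n m \<Longrightarrow> dg n f * (dg n g * A) = dg n (\<lambda>i. f i * g i) * A"
  by (simp add: dg_mult_dg flip: assoc_mult_mat[of _ n n _ n _ m])

lemma dg_one: "dg n (\<lambda>_. 1) = 1\<^sub>m n"
  by (rule eq_matI) auto

text \<open>Gram-Schmidt started at an eigenvector keeps its first vector, so the first column of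
  \<open>W\<close> is a multiple of \<open>v\<close> and orthogonality clears the rest of the
  column. The vectors returned are orthogonal but not normalised, hence the division by
  \<open>sqrt (N j)\<close>.\<close>

lemma exists_unitary_with_eigenvector:
  fixes A :: "complex mat"
  assumes A: "A \<in> carrier_mat (Suc n) (Suc n)"
  obtains W e where "unitary (Suc n) W"
    "\<And>i. i < Suc n \<Longrightarrow> (mat_adjoint W * A * W) $$ (i, 0) = (if i = 0 then e else 0)"
proof -
  let ?n = "Suc n"
  obtain e where "eigenvalue A e" using spectrum_non_empty[OF A] by (auto simp: spectrum_def)
  then obtain v where ev: "eigenvector A v e" by (auto simp: eigenvalue_def)
  hence v: "v \<in> carrier_vec ?n" and v0: "v \<noteq> 0\<^sub>v ?n" and Av: "A *\<^sub>v v = e \<cdot>\<^sub>v v"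
    using A by (auto simp: eigenvector_def)
  interpret cof_vec_space ?n "TYPE(complex)" .
  define b where "b = basis_completion v"
  define ws where "ws = gram_schmidt ?n b"
  from basis_completion[OF v v0, folded b_def]
  have dist_b: "distinct b" 
    and indep: "\<not> lin_dep (set b)" and b: "set b \<subseteq> carrier_vec ?n" and hdb: "hd b = v" 
    and len_b: "length b = ?n" by auto
  from hdb len_b obtain vs where bv: "b = v # vs" by (cases b) auto
  from gram_schmidt_result[OF b dist_b indep refl, folded ws_def]
  have ws: "set ws \<subseteq> carrier_vec ?n" "corthogonal ws" "length ws = ?n" 
    by (auto simp: len_b)
  from gram_schmidt_hd[OF v, of vs, folded bv] have hdws: "ws ! 0 = v"
    using ws(3) unfolding ws_def[symmetric] by (cases ws) auto
  have wsc: "ws ! i \<in> carrier_vec ?n" if "i < ?n" for i using ws that by auto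
  define N where "N i = (\<Sum>k<?n. (cmod ((ws ! i) $ k))\<^sup>2)" for i
  have ip: "(ws ! i) \<bullet>c (ws ! j) = (\<Sum>k<?n. (ws ! i) $ k * cnj ((ws ! j) $ k))" if "i < ?n" "j < ?n" for i j
    using wsc[OF that(1)] wsc[OF that(2)] by (simp add: scalar_prod_def lessThan_atLeast0)
  have orth: "(\<Sum>k<?n. (ws ! i) $ k * cnj ((ws ! j) $ k)) = (if i = j then complex_of_real (N i) else 0)"
    if "i < ?n" "j < ?n" for i j
  proof (cases "i = j")
    case True
    then show ?thesis by (simp add: N_def complex_norm_square flip: of_real_power)
  next
    case False
    thus ?thesis using ws(2,3) that ip[OF that] corthogonalD by fastforce
  qed
  have Npos: "N i > 0" if "i < ?n" for i
  proof -
    have "N i \<ge> 0" by (simp add: N_def sum_nonneg)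
    moreover have "(ws ! i) \<bullet>c (ws ! i) \<noteq> 0" using ws(2,3) that corthogonalD by fastforce
    ultimately show ?thesis using ip[OF that that] orth[OF that that] by force
  qed
  define W where "W = mat ?n ?n (\<lambda>(i, j). (ws ! j) $ i / complex_of_real (sqrt (N j)))"
  have W: "W \<in> carrier_mat ?n ?n" by (simp add: W_def)
  have WW: "mat_adjoint W * W = 1\<^sub>m ?n"
  proof (rule eq_matI)
    fix i j assume "i < dim_row (1\<^sub>m ?n)" "j < dim_col (1\<^sub>m ?n)"
    hence i: "i < ?n" and j: "j < ?n" by auto
    have "(mat_adjoint W * W) $$ (i, j) = (\<Sum>k<?n. cnj (W $$ (k, i)) * W $$ (k, j))"
      unfolding mult_index[OF adj_carrier[OF W] W i j] by (rule sum.cong) (use W i j in auto)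
    also have "\<dots> = (\<Sum>k<?n. (ws ! j) $ k * cnj ((ws ! i) $ k)) / complex_of_real (sqrt (N i) * sqrt (N j))"
      unfolding sum_divide_distrib using i j by (intro sum.cong) (auto simp: W_def)
    also have "\<dots> = 1\<^sub>m ?n $$ (i, j)" unfolding orth[OF j i] using i j Npos[OF i]
      by (auto simp flip: of_real_mult)
    finally show "(mat_adjoint W * W) $$ (i, j) = 1\<^sub>m ?n $$ (i, j)" .
  qed (use W in auto)
  have uW: "unitary ?n W" by (rule unitaryI[OF W WW])
  have Avi: "(\<Sum>k<?n. A $$ (i, k) * v $ k) = e * v $ i" if "i < ?n" for i
  proof -
    have "(A *\<^sub>v v) $ i = (e \<cdot>\<^sub>v v) $ i" by (simp only: Av)
    thus ?thesis using that A v by (simp add: scalar_prod_def lessThan_atLeast0)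
  qed
  have AW: "(A * W) $$ (i, 0) = e * W $$ (i, 0)" if "i < ?n" for i
  proof -
    have "(A * W) $$ (i, 0) = (\<Sum>k<?n. A $$ (i, k) * v $ k) / complex_of_real (sqrt (N 0))"
      unfolding mult_index[OF A W that zero_less_Suc] sum_divide_distrib
      by (rule sum.cong) (auto simp: W_def hdws)
    thus ?thesis using that Avi[OF that] by (simp add: W_def hdws)
  qed
  have "(mat_adjoint W * A * W) $$ (i, 0) = (if i = 0 then e else 0)" if i: "i < ?n" for i
  proof -
    have "mat_adjoint W * A * W = mat_adjoint W * (A * W)" using A W
      by (intro assoc_mult_mat[of _ ?n ?n _ ?n _ ?n]) auto
    hence "(mat_adjoint W * A * W) $$ (i, 0) = (\<Sum>k<?n. mat_adjoint W $$ (i, k) * (A * W) $$ (k, 0))"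
      using mult_index[of "mat_adjoint W" ?n ?n "A * W" ?n i 0] A W i by (simp del: index_mult_mat(1))
    also have "\<dots> = e * (\<Sum>k<?n. mat_adjoint W $$ (i, k) * W $$ (k, 0))"
      unfolding sum_distrib_left by (rule sum.cong) (auto simp: AW simp del: index_mult_mat(1))
    also have "\<dots> = e * (mat_adjoint W * W) $$ (i, 0)"
      by (subst mult_index[OF adj_carrier[OF W] W i]) auto
    also have "\<dots> = (if i = 0 then e else 0)" unfolding WW using i by auto
    finally show ?thesis .
  qed
  with uW show ?thesis using that by blast
qed

text \<open>Deflation: since \<open>B\<close> is Hermitian, the zeros in its first column also clear
  its first row, and a smaller Hermitian block remains. Hermiticity also makes the split-off
  eigenvalue real, so that \<open>l\<close> can be real-valued.\<close>

theorem hermitian_spectral: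
  fixes A :: "complex mat"
  assumes "A \<in> carrier_mat n n" "mat_adjoint A = A"
  shows "\<exists>U l. unitary n U \<and> A = U * dg n l * mat_adjoint U"
  using assms
proof (induction n arbitrary: A)
  case 0
  have "unitary 0 (1\<^sub>m 0)" by (intro unitaryI eq_matI) auto
  moreover have "A = 1\<^sub>m 0 * dg 0 (\<lambda>_. 0) * mat_adjoint (1\<^sub>m 0)" using 0 by (intro eq_matI) auto
  ultimately show ?case by blast
next
  case (Suc n)
  let ?n = "Suc n"
  note A = Suc.prems(1)
  obtain W e where uW: "unitary ?n W" and col: 
    "\<And>i. i < Suc n \<Longrightarrow> (mat_adjoint W * A * W) $$ (i, 0) = (if i = 0 then e else 0)"
    using exists_unitary_with_eigenvector[OF A] by metis
  note W = unitaryD[OF uW]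
  define B where "B = mat_adjoint W * A * W"
  have B: "B \<in> carrier_mat ?n ?n" using A W by (simp add: B_def)
  have Bh: "mat_adjoint B = B" using A W Suc.prems(2)
    by (simp add: B_def adj_mult[of _ ?n ?n _ ?n] assoc_mult_mat[of _ ?n ?n _ ?n _ ?n])
  have Bc: "B $$ (i, j) = cnj (B $$ (j, i))" if "i < ?n" "j < ?n" for i j
    using adj_index[of i B j] that B Bh by auto
  have AB: "A = W * B * mat_adjoint W" using A W unfolding B_def
    by (simp add: assoc_mult_mat[of _ ?n ?n _ ?n _ ?n] unitary_cancel[OF uW])
  have col': "B $$ (Suc i, 0) = 0" "B $$ (0, Suc i) = 0" if "i < n" for i
    using col[of "Suc i"] Bc[of 0 "Suc i"] that by (auto simp: B_def[symmetric])
  define B' where "B' = mat n n (\<lambda>(i, j). B $$ (Suc i, Suc j))"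
  have B': "B' \<in> carrier_mat n n" by (simp add: B'_def)
  have "mat_adjoint B' = B'" by (rule eq_matI) (auto simp: B'_def Bc[of "Suc _" "Suc _", symmetric])
  from Suc.IH[OF B' this] obtain U l where uU: "unitary n U" and BU: "B' = U * dg n l * mat_adjoint U" by blast
  note U = unitaryD[OF uU]
  \<comment> \<open>The direct sum of the 1 by 1 identity and \<open>U\<close>.\<close>
  define Z where "Z = mat ?n ?n (\<lambda>(i, j). case i of 0 \<Rightarrow> (if j = 0 then 1 else 0) |
     Suc i' \<Rightarrow> (case j of 0 \<Rightarrow> 0 | Suc j' \<Rightarrow> U $$ (i', j')))"
  have Z: "Z \<in> carrier_mat ?n ?n" by (simp add: Z_def)
  have Zi: "Z $$ (0, 0) = 1" "\<And>i. i < n \<Longrightarrow> Z $$ (Suc i, 0) = 0" "\<And>i. i < n \<Longrightarrow> Z $$ (0, Suc i) = 0"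
    "\<And>i j. i < n \<Longrightarrow> j < n \<Longrightarrow> Z $$ (Suc i, Suc j) = U $$ (i, j)" by (auto simp: Z_def)
  have "mat_adjoint Z * Z = 1\<^sub>m ?n"
  proof (rule eq_matI)
    fix i j assume "i < dim_row (1\<^sub>m ?n)" "j < dim_col (1\<^sub>m ?n)"
    hence i: "i < ?n" and j: "j < ?n" by auto
    have "(mat_adjoint Z * Z) $$ (i, j) = (\<Sum>k<?n. cnj (Z $$ (k, i)) * Z $$ (k, j))"
      unfolding mult_index[OF adj_carrier[OF Z] Z i j] by (rule sum.cong) (use Z i j in auto)
    also have "\<dots> = 1\<^sub>m ?n $$ (i, j)"
    proof (cases "i = 0 \<or> j = 0")
      case True
      then show ?thesis using i j unfolding sum.lessThan_Suc_shift
        by (cases i; cases j) (auto simp: Zi)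
    next
      case False
      then obtain i' j' where ij: "i = Suc i'" "j = Suc j'" by (cases i; cases j) auto
      hence ij': "i' < n" "j' < n" using i j by auto
      have "(\<Sum>k<?n. cnj (Z $$ (k, i)) * Z $$ (k, j)) = (\<Sum>k<n. mat_adjoint U $$ (i', k) * U $$ (k, j'))"
        unfolding sum.lessThan_Suc_shift using ij ij' U by (auto simp: Zi intro!: sum.cong)
      also have "\<dots> = (mat_adjoint U * U) $$ (i', j')" using U ij' by (subst mult_index[of _ n n _ n]) auto
      finally show ?thesis using U ij ij' by auto
    qed
    finally show "(mat_adjoint Z * Z) $$ (i, j) = 1\<^sub>m ?n $$ (i, j)" .
  qed (use Z in auto)
  hence uZ: "unitary ?n Z" by (rule unitaryI[OF Z])
  define m where "m i = (case i of 0 \<Rightarrow> Re (B $$ (0, 0)) | Suc i' \<Rightarrow> l i')" for i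
  have ZdZ: "Z * dg ?n m * mat_adjoint Z = B"
  proof (rule eq_matI)
    fix i j assume "i < dim_row B" "j < dim_col B"
    hence i: "i < ?n" and j: "j < ?n" using B by auto
    have "(Z * dg ?n m * mat_adjoint Z) $$ (i, j) = (\<Sum>k<?n. (Z * dg ?n m) $$ (i, k) * mat_adjoint Z $$ (k, j))"
      using Z i j by (subst mult_index[of _ ?n ?n _ ?n]) auto
    also have "\<dots> = (\<Sum>k<?n. Z $$ (i, k) * of_real (m k) * cnj (Z $$ (j, k)))"
      by (rule sum.cong) (use Z i j in \<open>auto simp: dg_mult_right_index[OF Z] simp del: index_mult_mat(1)\<close>)
    also have "\<dots> = B $$ (i, j)"
    proof (cases "i = 0 \<or> j = 0")
      case True
      have "B $$ (0, 0) = complex_of_real (Re (B $$ (0, 0)))" using Bc[of 0 0] 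
        by (metis Reals_cnj_iff complex_is_Real_iff complex_eq_iff Re_complex_of_real Im_complex_of_real zero_less_Suc)
      with True show ?thesis using i j unfolding sum.lessThan_Suc_shift
        by (cases i; cases j) (auto simp: Zi m_def col')
    next
      case False
      then obtain i' j' where ij: "i = Suc i'" "j = Suc j'" by (cases i; cases j) auto
      hence ij': "i' < n" "j' < n" using i j by auto
      have "(\<Sum>k<?n. Z $$ (i, k) * of_real (m k) * cnj (Z $$ (j, k))) =
          (\<Sum>k<n. (U * dg n l) $$ (i', k) * mat_adjoint U $$ (k, j'))"
        unfolding sum.lessThan_Suc_shift using ij ij' U 
        by (auto simp: Zi m_def dg_mult_right_index[OF U(1)] simp del: index_mult_mat(1) intro!: sum.cong)
      also have "\<dots> = B' $$ (i', j')" unfolding BU using U ij' by (subst mult_index[of _ n n _ n]) auto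
      finally show ?thesis using ij ij' by (simp add: B'_def)
    qed
    finally show "(Z * dg ?n m * mat_adjoint Z) $$ (i, j) = B $$ (i, j)" .
  qed (use Z B in auto)
  have "A = (W * Z) * dg ?n m * mat_adjoint (W * Z)"
    using W Z unfolding AB ZdZ[symmetric]
    by (simp add: adj_mult[of _ ?n ?n _ ?n] assoc_mult_mat[of _ ?n ?n _ ?n _ ?n])
  with unitary_mult[OF uW uZ] show ?case by blast
qed

section \<open>Functional calculus, trace norm and Frobenius norm\<close>

lemma sandwich_dg_index:
  assumes U: "U \<in> carrier_mat n n" and V: "V \<in> carrier_mat n n" and i: "i < n" and j: "j < n"
  shows "(U * dg n l * mat_adjoint V) $$ (i, j) = (\<Sum>k<n. U $$ (i, k) * complex_of_real (l k) * cnj (V $$ (j, k)))"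
proof -
  have "(U * dg n l * mat_adjoint V) $$ (i, j) = (\<Sum>k<n. (U * dg n l) $$ (i, k) * mat_adjoint V $$ (k, j))"
    using U V i j by (subst mult_index[of _ n n _ n]) auto
  thus ?thesis using assms
    by (auto simp: dg_mult_right_index[OF U] simp del: index_mult_mat(1) intro!: sum.cong)
qed

lemma sandwich_dg_mult:
  assumes "unitary n U"
  shows "(U * dg n l * mat_adjoint U) * (U * dg n m * mat_adjoint U) = U * dg n (\<lambda>i. l i * m i) * mat_adjoint U"
  using unitaryD[OF assms]
  by (simp add: assoc_mult_mat[of _ n n _ n _ n] unitary_cancel[OF assms, of _ n] dg_mult_dg_left[of _ n n])

lemma sandwich_dg_adj:
  assumes "U \<in> carrier_mat n n"
  shows "mat_adjoint (U * dg n l * mat_adjoint U) = U * dg n l * mat_adjoint U"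
  using assms by (simp add: adj_mult[of _ n n _ n] assoc_mult_mat[of _ n n _ n _ n])

lemma sandwich_dg_pow:
  assumes "unitary n U"
  shows "(U * dg n l * mat_adjoint U) ^\<^sub>m k = U * dg n (\<lambda>i. l i ^ k) * mat_adjoint U"
proof (induction k)
  case 0
  show ?case using unitaryD[OF assms] by (simp add: dg_one)
next
  case (Suc k)
  show ?case by (simp add: Suc sandwich_dg_mult[OF assms] mult.commute)
qed

lemma poly_interp:
  assumes "finite S" "a \<in> S"
  shows "poly (interp g S) a = g a"
proof -
  have "poly (\<Prod>b\<in>S - {c}. Polynomial.smult (1 / (c - b)) [:- b, 1:]) a = (if c = a then 1 else 0)"
    if "c \<in> S" for c
  proof (cases "c = a")
    case True
    have "poly (Polynomial.smult (1 / (c - b)) [:- b, 1:]) a = (a - b) / (c - b)" for b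
      by (simp add: divide_inverse algebra_simps)
    thus ?thesis using True by (auto simp: poly_prod simp del: poly_smult intro!: prod.neutral split: if_splits)
  next
    case False
    thus ?thesis using assms by (auto simp: poly_prod intro!: prod_zero bexI[of _ a])
  qed
  hence "poly (interp g S) a = (\<Sum>c\<in>S. g c * (if c = a then 1 else 0))"
    by (simp add: interp_def poly_sum)
  thus ?thesis using assms by (simp add: if_distrib[of "\<lambda>x. _ * x"] cong: if_cong)
qed

text \<open>\<open>interp\<close> prescribes values at the points of the spectrum only, so every
  diagonal entry has to be recognised as one of its nodes.\<close>

lemma sandwich_dg_spectrum:
  assumes u: "unitary n U" and k: "k < n"
  shows "complex_of_real (l k) \<in> spectrum (U * dg n l * mat_adjoint U)"
proof -
  note U = unitaryD[OF u]
  let ?A = "U * dg n l * mat_adjoint U"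
  have AU: "?A * U = U * dg n l" using U
    by (simp add: assoc_mult_mat[of _ n n _ n _ n])
  have "?A *\<^sub>v col U k = col (?A * U) k" using U k by (subst col_mult2[of _ n n _ n]) auto
  also have "\<dots> = complex_of_real (l k) \<cdot>\<^sub>v col U k" unfolding AU
    using U k by (intro eq_vecI) (auto simp: dg_mult_right_index[OF U(1)] mult.commute simp del: index_mult_mat(1))
  finally have ev: "?A *\<^sub>v col U k = complex_of_real (l k) \<cdot>\<^sub>v col U k" .
  have "col U k \<noteq> 0\<^sub>v n"
  proof
    assume z: "col U k = 0\<^sub>v n"
    have "U $$ (i, k) = 0" if "i < n" for i using arg_cong[OF z, of "\<lambda>v. v $ i"] U k that by simp
    hence "(mat_adjoint U * U) $$ (k, k) = 0"
      using mult_index[OF U(2) U(1) k k] by simp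
    thus False using U k by simp
  qed
  thus ?thesis using ev U k
    by (auto simp: spectrum_def eigenvalue_def eigenvector_def intro!: exI[of _ "col U k"])
qed

text \<open>A polynomial acts on the diagonal entries, and the interpolation polynomial agrees with
  \<open>f\<close> there. Any diagonalisation may thus serve to compute \<open>mat_fun\<close>, so
  logarithms and square roots are read off from eigenvalues.\<close>

lemma mat_fun_sandwich_dg:
  assumes u: "unitary n U"
  shows "mat_fun f (U * dg n l * mat_adjoint U) = U * dg n (\<lambda>i. f (l i)) * mat_adjoint U"
proof -
  note U = unitaryD[OF u]
  let ?A = "U * dg n l * mat_adjoint U"
  define p where "p = interp (\<lambda>z. complex_of_real (f (Re z))) (spectrum ?A)"
  have A: "?A \<in> carrier_mat n n" using U by simp
  have p: "poly p (complex_of_real (l k)) = complex_of_real (f (l k))" if "k < n" for k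
    unfolding p_def using poly_interp[OF card_finite_spectrum(1)[OF A] sandwich_dg_spectrum[OF u that]] by simp
  show ?thesis unfolding mat_fun_def p_def[symmetric]
  proof (rule eq_matI)
    fix i j assume "i < dim_row (U * dg n (\<lambda>i. f (l i)) * mat_adjoint U)"
      "j < dim_col (U * dg n (\<lambda>i. f (l i)) * mat_adjoint U)"
    hence i: "i < n" and j: "j < n" using U by auto
    have "mat_poly p ?A $$ (i, j) = (\<Sum>k\<le>degree p. coeff p k * (\<Sum>m<n. U $$ (i, m) * complex_of_real (l m ^ k) * cnj (U $$ (j, m))))"
      using U i j by (simp add: mat_poly_def sandwich_dg_pow[OF u] sandwich_dg_index del: index_mult_mat(1))
    also have "\<dots> = (\<Sum>k\<le>degree p. \<Sum>m<n. U $$ (i, m) * (coeff p k * complex_of_real (l m) ^ k) * cnj (U $$ (j, m)))"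
      by (simp add: sum_distrib_left mult_ac)
    also have "\<dots> = (\<Sum>m<n. \<Sum>k\<le>degree p. U $$ (i, m) * (coeff p k * complex_of_real (l m) ^ k) * cnj (U $$ (j, m)))"
      by (rule sum.swap)
    also have "\<dots> = (\<Sum>m<n. U $$ (i, m) * poly p (complex_of_real (l m)) * cnj (U $$ (j, m)))"
      unfolding poly_altdef sum_distrib_left sum_distrib_right ..
    also have "\<dots> = (U * dg n (\<lambda>i. f (l i)) * mat_adjoint U) $$ (i, j)"
      using U i j p by (subst sandwich_dg_index) auto
    finally show "mat_poly p ?A $$ (i, j) = (U * dg n (\<lambda>i. f (l i)) * mat_adjoint U) $$ (i, j)" .
  qed (use U in \<open>auto simp: mat_poly_def\<close>)
qed

section \<open>Traces, duality for the trace norm and Cauchy-Schwarz\<close>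

lemma mtrace_mult:
  assumes A: "A \<in> carrier_mat n m" and B: "B \<in> carrier_mat m n"
  shows "mtrace (A * B) = (\<Sum>i<n. \<Sum>j<m. A $$ (i, j) * B $$ (j, i))"
  using A B by (auto simp: mtrace_def mult_index[OF A B] simp del: index_mult_mat(1) intro!: sum.cong)

lemma mtrace_cyclic:
  assumes A: "A \<in> carrier_mat n m" and B: "B \<in> carrier_mat m n"
  shows "mtrace (A * B) = mtrace (B * A)"
  unfolding mtrace_mult[OF A B] mtrace_mult[OF B A] by (subst sum.swap) (simp add: mult.commute)

lemma mtrace_add:
  assumes "A \<in> carrier_mat n n" "B \<in> carrier_mat n n"
  shows "mtrace (A + B) = mtrace A + mtrace B"
  using assms by (auto simp: mtrace_def sum.distrib)

lemma mtrace_minus: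
  assumes "A \<in> carrier_mat n n" "B \<in> carrier_mat n n"
  shows "mtrace (A - B) = mtrace A - mtrace B"
  using assms by (auto simp: mtrace_def sum_subtractf)

text \<open>For a state \<open>A\<close> the diagonal entries on the right are the outcome
  probabilities of a measurement in the basis \<open>U\<close>; this turns entropies and relative
  entropies into classical sums.\<close>

lemma mtrace_mult_sandwich_dg:
  assumes A: "A \<in> carrier_mat n n" and U: "U \<in> carrier_mat n n"
  shows "mtrace (A * (U * dg n l * mat_adjoint U)) = (\<Sum>k<n. (mat_adjoint U * A * U) $$ (k, k) * complex_of_real (l k))"
proof -
  have "mtrace (A * (U * dg n l * mat_adjoint U)) = mtrace ((A * U * dg n l) * mat_adjoint U)"
    using A U by (simp add: assoc_mult_mat[of _ n n _ n _ n])
  also have "\<dots> = mtrace (mat_adjoint U * (A * U * dg n l))"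
    by (rule mtrace_cyclic) (use A U in auto)
  also have "mat_adjoint U * (A * U * dg n l) = mat_adjoint U * A * U * dg n l"
    using A U by (simp add: assoc_mult_mat[of _ n n _ n _ n])
  also have "mtrace \<dots> = (\<Sum>k<n. (mat_adjoint U * A * U) $$ (k, k) * complex_of_real (l k))"
    using A U by (simp add: mtrace_def dg_mult_right_index[of _ n n] del: index_mult_mat(1))
  finally show ?thesis .
qed

lemma mtrace_sandwich_dg:
  assumes u: "unitary n U"
  shows "mtrace (U * dg n l * mat_adjoint U) = complex_of_real (\<Sum>k<n. l k)"
  using mtrace_mult_sandwich_dg[of "1\<^sub>m n" n U l] unitaryD[OF u] by simp

text \<open>The maximiser in the dual description of the trace norm is the sign of
  \<open>A\<close>.\<close>

lemma trace_norm_variational: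
  assumes A: "A \<in> carrier_mat n n" "mat_adjoint A = A"
  obtains S where "unitary n S" "trace_norm A = Re (mtrace (S * A))" "0 \<le> trace_norm A"
proof -
  obtain U l where u: "unitary n U" and AU: "A = U * dg n l * mat_adjoint U"
    using hermitian_spectral[OF A] by blast
  note U = unitaryD[OF u]
  \<comment> \<open>Zero gets sign 1, so that \<open>S\<close> is unitary even for singular
    \<open>A\<close>.\<close>
  define s where "s i = (if l i < 0 then -1 else 1::real)" for i
  define S where "S = U * dg n s * mat_adjoint U"
  have S: "S \<in> carrier_mat n n" using U by (simp add: S_def)
  have "mat_adjoint S * S = 1\<^sub>m n" unfolding S_def sandwich_dg_adj[OF U(1)] sandwich_dg_mult[OF u]
    using U by (simp add: s_def dg_one if_distrib[of "\<lambda>x. x * _"] cong: if_cong)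
  hence uS: "unitary n S" by (rule unitaryI[OF S])
  have tn: "trace_norm A = (\<Sum>k<n. \<bar>l k\<bar>)"
    unfolding trace_norm_def A(2) unfolding AU sandwich_dg_mult[OF u] mat_fun_sandwich_dg[OF u] mtrace_sandwich_dg[OF u]
    by simp
  have sl: "s i * l i = \<bar>l i\<bar>" for i by (simp add: s_def)
  have "Re (mtrace (S * A)) = (\<Sum>k<n. \<bar>l k\<bar>)"
    unfolding AU S_def sandwich_dg_mult[OF u] mtrace_sandwich_dg[OF u] sl by simp
  with uS tn show ?thesis using that[of S] by (simp add: sum_nonneg)
qed

text \<open>The square of the Hilbert-Schmidt norm; without the root it is additive over
  blocks.\<close>

definition fro :: "complex mat \<Rightarrow> real" where
  "fro A = (\<Sum>i<dim_row A. \<Sum>j<dim_col A. (cmod (A $$ (i, j)))\<^sup>2)"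

lemma fro_nonneg: "0 \<le> fro A"
  by (simp add: fro_def sum_nonneg)

lemma fro_trace:
  assumes A: "A \<in> carrier_mat n n"
  shows "complex_of_real (fro A) = mtrace (mat_adjoint A * A)"
  unfolding mtrace_mult[OF adj_carrier[OF A] A] using A
  by (subst sum.swap) (auto simp: fro_def complex_norm_square mult.commute simp flip: of_real_power intro!: sum.cong)

lemma fro_adj: "fro (mat_adjoint A) = fro A"
  unfolding fro_def by (subst sum.swap) (auto intro!: sum.cong)

lemma fro_unitary_left:
  assumes u: "unitary n U" and A: "A \<in> carrier_mat n n"
  shows "fro (U * A) = fro A"
proof -
  note U = unitaryD[OF u]
  have "complex_of_real (fro (U * A)) = mtrace (mat_adjoint (U * A) * (U * A))"
    using fro_trace[of "U * A" n] U A by simp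
  also have "mat_adjoint (U * A) * (U * A) = mat_adjoint A * A"
    using U A by (simp add: adj_mult[of _ n n _ n] assoc_mult_mat[of _ n n _ n _ n] unitary_cancel[OF u, of _ n])
  finally show ?thesis unfolding fro_trace[OF A, symmetric] by simp
qed

lemma fro_unitary_right:
  assumes u: "unitary n U" and A: "A \<in> carrier_mat n n"
  shows "fro (A * U) = fro A"
proof -
  have "fro (A * U) = fro (mat_adjoint U * mat_adjoint A)"
    using adj_mult[of A n n U n] A unitaryD[OF u] fro_adj[of "A * U"] by simp
  also have "\<dots> = fro A" using fro_unitary_left[OF unitary_adj[OF u] adj_carrier[OF A]] by (simp add: fro_adj)
  finally show ?thesis .
qed

lemma fro_dg: "fro (dg n f) = (\<Sum>i<n. (f i)\<^sup>2)"
proof -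
  have "fro (dg n f) = (\<Sum>i<n. \<Sum>j<n. if i = j then (f i)\<^sup>2 else 0)"
    unfolding fro_def dg_dim by (intro sum.cong refl) simp
  thus ?thesis by simp
qed

text \<open>Cauchy-Schwarz for the Hilbert-Schmidt inner product.\<close>

lemma mtrace_mult_le_fro:
  assumes A: "A \<in> carrier_mat n m" and B: "B \<in> carrier_mat m n"
  shows "cmod (mtrace (A * B)) \<le> sqrt (fro A) * sqrt (fro B)"
proof -
  let ?I = "{..<n} \<times> {..<m}"
  have "cmod (mtrace (A * B)) = cmod (\<Sum>(i, j)\<in>?I. A $$ (i, j) * B $$ (j, i))"
    unfolding mtrace_mult[OF A B] by (simp add: sum.cartesian_product)
  also have "\<dots> \<le> (\<Sum>(i, j)\<in>?I. cmod (A $$ (i, j)) * cmod (B $$ (j, i)))"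
    by (rule order_trans[OF norm_sum]) (auto simp: norm_mult intro!: sum_mono)
  also have "\<dots> = (\<Sum>z\<in>?I. \<bar>cmod (A $$ z)\<bar> * \<bar>cmod (B $$ (snd z, fst z))\<bar>)"
    by (rule sum.cong) auto
  also have "\<dots> \<le> L2_set (\<lambda>z. cmod (A $$ z)) ?I * L2_set (\<lambda>z. cmod (B $$ (snd z, fst z))) ?I"
    by (rule L2_set_mult_ineq)
  also have "L2_set (\<lambda>z. cmod (A $$ z)) ?I = sqrt (fro A)"
    using A by (simp add: L2_set_def fro_def sum.cartesian_product split_def)
  also have "L2_set (\<lambda>z. cmod (B $$ (snd z, fst z))) ?I = sqrt (fro (mat_adjoint B))"
    using B by (simp add: L2_set_def fro_def sum.cartesian_product split_def)
  finally show ?thesis by (simp add: fro_adj)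
qed

section \<open>Tensor products and concentration of product distributions\<close>

text \<open>An index of a Kronecker product is a pair of indices packed by \<open>div\<close> and
  \<open>mod\<close>; this is how sums over it factorise.\<close>

lemma sum_div_mod:
  fixes F :: "nat \<Rightarrow> nat \<Rightarrow> 'a::comm_monoid_add"
  shows "(\<Sum>i<a * b. F (i div b) (i mod b)) = (\<Sum>i<a. \<Sum>j<b. F i j)"
proof -
  have "(\<Sum>i<a * b. F (i div b) (i mod b)) = (\<Sum>i<a. \<Sum>k = i * b..<i * b + b. F (k div b) (k mod b))"
    by (rule sum.nat_group[symmetric])
  also have "\<dots> = (\<Sum>i<a. \<Sum>j<b. F i j)"
  proof (rule sum.cong)
    fix i
    have "(\<Sum>k = i * b..<i * b + b. F (k div b) (k mod b)) = (\<Sum>j = 0..<b. F ((j + i * b) div b) ((j + i * b) mod b))"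
      using sum.shift_bounds_nat_ivl[of "\<lambda>k. F (k div b) (k mod b)" 0 "i * b" b] by (simp add: add.commute)
    also have "\<dots> = (\<Sum>j<b. F i j)"
      unfolding lessThan_atLeast0 by (rule sum.cong) auto
    finally show "(\<Sum>k = i * b..<i * b + b. F (k div b) (k mod b)) = (\<Sum>j<b. F i j)" .
  qed simp
  finally show ?thesis .
qed

lemma div_mod_less:
  assumes "i < a * (b::nat)"
  shows "i div b < a" "i mod b < b"
  using assms by (auto simp: less_mult_imp_div_less) (metis mod_less_divisor mult_0_right not_gr_zero not_less_zero)

section \<open>Kronecker products and tensor products of lists\<close>

lemma kron_dim [simp]:
  "dim_row (kron A B) = dim_row A * dim_row B" "dim_col (kron A B) = dim_col A * dim_col B"
  by (auto simp: kron_def)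

lemma kron_carrier [simp]:
  "A \<in> carrier_mat d d \<Longrightarrow> B \<in> carrier_mat m m \<Longrightarrow> kron A B \<in> carrier_mat (d * m) (d * m)"
  by (auto simp: kron_def)

lemma kron_index:
  assumes "A \<in> carrier_mat d d" "B \<in> carrier_mat m m" "i < d * m" "j < d * m"
  shows "kron A B $$ (i, j) = A $$ (i div m, j div m) * B $$ (i mod m, j mod m)"
  using assms by (auto simp: kron_def)

lemma kron_mult:
  assumes A: "A \<in> carrier_mat d d" and B: "B \<in> carrier_mat m m"
    and C: "C \<in> carrier_mat d d" and D: "D \<in> carrier_mat m m"
  shows "kron A B * kron C D = kron (A * C) (B * D)"
proof (rule eq_matI)
  fix i j assume "i < dim_row (kron (A * C) (B * D))" "j < dim_col (kron (A * C) (B * D))"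
  hence i: "i < d * m" and j: "j < d * m" using A B C D by (auto simp: kron_def)
  note ij = div_mod_less[OF i] div_mod_less[OF j]
  have "(kron A B * kron C D) $$ (i, j) = (\<Sum>k<d * m. kron A B $$ (i, k) * kron C D $$ (k, j))"
    by (rule mult_index) (use A B C D i j in auto)
  also have "\<dots> = (\<Sum>k<d * m. (A $$ (i div m, k div m) * C $$ (k div m, j div m)) * (B $$ (i mod m, k mod m) * D $$ (k mod m, j mod m)))"
    by (rule sum.cong) (use i j in \<open>auto simp: kron_index[OF A B] kron_index[OF C D]\<close>)
  also have "\<dots> = (\<Sum>k<d. \<Sum>l<m. (A $$ (i div m, k) * C $$ (k, j div m)) * (B $$ (i mod m, l) * D $$ (l, j mod m)))"
    by (rule sum_div_mod)
  also have "\<dots> = (A * C) $$ (i div m, j div m) * (B * D) $$ (i mod m, j mod m)"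
    unfolding mult_index[OF A C ij(1) ij(3)] mult_index[OF B D ij(2) ij(4)] sum_product ..
  also have "\<dots> = kron (A * C) (B * D) $$ (i, j)"
    using A B C D i j by (subst kron_index[of _ d _ m]) auto
  finally show "(kron A B * kron C D) $$ (i, j) = kron (A * C) (B * D) $$ (i, j)" .
qed (use A B C D in \<open>auto simp: kron_def\<close>)

lemma kron_adj:
  assumes A: "A \<in> carrier_mat d d" and B: "B \<in> carrier_mat m m"
  shows "mat_adjoint (kron A B) = kron (mat_adjoint A) (mat_adjoint B)"
proof (rule eq_matI)
  fix i j assume "i < dim_row (kron (mat_adjoint A) (mat_adjoint B))" "j < dim_col (kron (mat_adjoint A) (mat_adjoint B))"
  hence i: "i < d * m" and j: "j < d * m" using A B by (auto simp: kron_def)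
  show "mat_adjoint (kron A B) $$ (i, j) = kron (mat_adjoint A) (mat_adjoint B) $$ (i, j)"
    using A B i j div_mod_less[OF i] div_mod_less[OF j]
    by (auto simp: kron_index[OF A B] kron_index[OF adj_carrier[OF A] adj_carrier[OF B]])
qed (use A B in \<open>auto simp: kron_def\<close>)

lemma tensor_list_simps [simp]:
  "tensor_list [] = 1\<^sub>m 1" "tensor_list (A # As) = kron A (tensor_list As)"
  by (simp_all add: tensor_list_def)

lemma tensor_list_carrier [simp]:
  assumes "\<And>x. A x \<in> carrier_mat d d"
  shows "tensor_list (map A xs) \<in> carrier_mat (d ^ length xs) (d ^ length xs)"
  by (induction xs) (simp_all add: assms)

lemma tensor_list_mult:
  assumes "\<And>x. A x \<in> carrier_mat d d" "\<And>x. B x \<in> carrier_mat d d"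
  shows "tensor_list (map A xs) * tensor_list (map B xs) = tensor_list (map (\<lambda>x. A x * B x) xs)"
proof (induction xs)
  case (Cons x xs)
  show ?case
    using kron_mult[OF assms(1) tensor_list_carrier[of A d xs, OF assms(1)] assms(2) tensor_list_carrier[of B d xs, OF assms(2)]]
    by (simp add: Cons)
qed simp

lemma tensor_list_adj:
  assumes "\<And>x. A x \<in> carrier_mat d d"
  shows "mat_adjoint (tensor_list (map A xs)) = tensor_list (map (\<lambda>x. mat_adjoint (A x)) xs)"
proof (induction xs)
  case Nil
  show ?case by (auto intro!: eq_matI)
next
  case (Cons x xs)
  thus ?case using kron_adj[OF assms tensor_list_carrier[of A d xs, OF assms]] by simp
qed

text \<open>The index \<open>i < d ^ n\<close> of a tensor product stands for its \<open>n\<close> digits in base \<open>d\<close>, the most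
  significant one belonging to the first factor.\<close>

primrec digit_prod :: "nat \<Rightarrow> ('x \<Rightarrow> nat \<Rightarrow> real) \<Rightarrow> 'x list \<Rightarrow> nat \<Rightarrow> real" where
  "digit_prod d a [] i = 1"
| "digit_prod d a (x # xs) i = a x (i div d ^ length xs) * digit_prod d a xs (i mod d ^ length xs)"

primrec digit_sum :: "nat \<Rightarrow> ('x \<Rightarrow> nat \<Rightarrow> real) \<Rightarrow> 'x list \<Rightarrow> nat \<Rightarrow> real" where
  "digit_sum d f [] i = 0"
| "digit_sum d f (x # xs) i = f x (i div d ^ length xs) + digit_sum d f xs (i mod d ^ length xs)"

lemma tensor_list_dg:
  "tensor_list (map (\<lambda>x. dg d (a x)) xs) = dg (d ^ length xs) (digit_prod d a xs)"
proof (induction xs)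
  case Nil
  show ?case by (auto intro!: eq_matI)
next
  case (Cons x xs)
  let ?m = "d ^ length xs"
  have "kron (dg d (a x)) (dg ?m (digit_prod d a xs)) = dg (d * ?m) (digit_prod d a (x # xs))"
  proof (rule eq_matI)
    fix i j assume "i < dim_row (dg (d * ?m) (digit_prod d a (x # xs)))" "j < dim_col (dg (d * ?m) (digit_prod d a (x # xs)))"
    hence i: "i < d * ?m" and j: "j < d * ?m" by auto
    have "i = j" if "i div ?m = j div ?m" "i mod ?m = j mod ?m" using that by (metis div_mult_mod_eq)
    thus "kron (dg d (a x)) (dg ?m (digit_prod d a xs)) $$ (i, j) = dg (d * ?m) (digit_prod d a (x # xs)) $$ (i, j)"
      using i j div_mod_less[OF i] div_mod_less[OF j]
      by (auto simp: kron_index[OF dg_carrier dg_carrier])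
  qed (auto simp: kron_def)
  with Cons show ?case by (simp del: digit_prod.simps)
qed

lemma tensor_list_one: "tensor_list (map (\<lambda>x. 1\<^sub>m d) xs) = 1\<^sub>m (d ^ length xs)"
proof -
  have "digit_prod d (\<lambda>_ _. 1) xs = (\<lambda>_. 1)" by (rule ext, rename_tac i, induct xs) auto
  thus ?thesis using tensor_list_dg[of d "\<lambda>_ _. 1" xs] by (simp add: dg_one)
qed

lemma tensor_list_unitary:
  assumes "\<And>x. unitary d (U x)"
  shows "unitary (d ^ length xs) (tensor_list (map U xs))"
proof (rule unitaryI)
  note U = unitaryD[OF assms]
  show "tensor_list (map U xs) \<in> carrier_mat (d ^ length xs) (d ^ length xs)" using U by simp
  show "mat_adjoint (tensor_list (map U xs)) * tensor_list (map U xs) = 1\<^sub>m (d ^ length xs)"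
    using U by (simp add: tensor_list_adj[of _ d] tensor_list_mult[of _ d] tensor_list_one)
qed

text \<open>A diagonal entry of a Kronecker product involves only diagonal entries of the factors.
  Measuring a product state in a product basis therefore yields a product distribution, even when
  the factors are not diagonal in that basis.\<close>

lemma tensor_list_diag:
  assumes A: "\<And>x. A x \<in> carrier_mat d d"
    and a: "\<And>x i. i < d \<Longrightarrow> A x $$ (i, i) = complex_of_real (a x i)"
  shows "i < d ^ length xs \<Longrightarrow> tensor_list (map A xs) $$ (i, i) = complex_of_real (digit_prod d a xs i)"
proof (induction xs arbitrary: i)
  case (Cons x xs)
  have i: "i < d * d ^ length xs" using Cons.prems by simp
  show ?case using i div_mod_less[OF i] Cons.IH
    by (simp add: kron_index[OF A tensor_list_carrier[OF A]] a)
qed simp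

lemma digit_prod_nonneg:
  assumes "\<And>x i. i < d \<Longrightarrow> 0 \<le> a x i"
  shows "i < d ^ length xs \<Longrightarrow> 0 \<le> digit_prod d a xs i"
proof (induction xs arbitrary: i)
  case (Cons x xs)
  have i: "i < d * d ^ length xs" using Cons.prems by simp
  show ?case using div_mod_less[OF i] Cons.IH assms by simp
qed simp

lemma digit_prod_sum:
  assumes "\<And>x. (\<Sum>i<d. a x i) = 1"
  shows "(\<Sum>i<d ^ length xs. digit_prod d a xs i) = 1"
proof (induction xs)
  case (Cons x xs)
  have "(\<Sum>i<d ^ length (x # xs). digit_prod d a (x # xs) i) = (\<Sum>i<d. \<Sum>j<d ^ length xs. a x i * digit_prod d a xs j)"
    unfolding length_Cons power_Suc digit_prod.simps digit_sum.simps by (rule sum_div_mod)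
  also have "\<dots> = 1" by (simp add: Cons assms flip: sum_product)
  finally show ?case .
qed simp

lemma digit_prod_moment1:
  assumes "\<And>x. (\<Sum>i<d. a x i) = 1" "\<And>x. (\<Sum>i<d. a x i * f x i) = 0"
  shows "(\<Sum>i<d ^ length xs. digit_prod d a xs i * digit_sum d f xs i) = 0"
proof (induction xs)
  case (Cons x xs)
  have "(\<Sum>i<d ^ length (x # xs). digit_prod d a (x # xs) i * digit_sum d f (x # xs) i)
     = (\<Sum>i<d. \<Sum>j<d ^ length xs. (a x i * digit_prod d a xs j) * (f x i + digit_sum d f xs j))"
    unfolding length_Cons power_Suc digit_prod.simps digit_sum.simps by (rule sum_div_mod)
  also have "\<dots> = (\<Sum>i<d. \<Sum>j<d ^ length xs. (a x i * f x i) * digit_prod d a xs j)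
      + (\<Sum>i<d. \<Sum>j<d ^ length xs. a x i * (digit_prod d a xs j * digit_sum d f xs j))"
    by (simp add: algebra_simps sum.distrib)
  also have "\<dots> = 0" by (simp add: Cons assms flip: sum_product)
  finally show ?case .
qed simp

text \<open>Under the weights \<open>digit_prod d a xs\<close> the digits are independent, and
  \<open>digit_sum d f xs\<close> is a sum of centred variables: the cross terms contain vanishing
  first moments, so variances add.\<close>

lemma digit_prod_moment2:
  assumes "\<And>x. (\<Sum>i<d. a x i) = 1" "\<And>x. (\<Sum>i<d. a x i * f x i) = 0"
  shows "(\<Sum>i<d ^ length xs. digit_prod d a xs i * (digit_sum d f xs i)\<^sup>2) = (\<Sum>x\<leftarrow>xs. \<Sum>i<d. a x i * (f x i)\<^sup>2)"
proof (induction xs)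
  case (Cons x xs)
  have "(\<Sum>i<d ^ length (x # xs). digit_prod d a (x # xs) i * (digit_sum d f (x # xs) i)\<^sup>2)
     = (\<Sum>i<d. \<Sum>j<d ^ length xs. (a x i * digit_prod d a xs j) * (f x i + digit_sum d f xs j)\<^sup>2)"
    unfolding length_Cons power_Suc digit_prod.simps digit_sum.simps by (rule sum_div_mod)
  also have "\<dots> = (\<Sum>i<d. \<Sum>j<d ^ length xs. (a x i * (f x i)\<^sup>2) * digit_prod d a xs j)
      + (\<Sum>i<d. \<Sum>j<d ^ length xs. (2 * (a x i * f x i)) * (digit_prod d a xs j * digit_sum d f xs j))
      + (\<Sum>i<d. \<Sum>j<d ^ length xs. a x i * (digit_prod d a xs j * (digit_sum d f xs j)\<^sup>2))"
    by (simp add: algebra_simps sum.distrib power2_sum)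
  also have "\<dots> = (\<Sum>i<d. a x i * (f x i)\<^sup>2) + (\<Sum>x\<leftarrow>xs. \<Sum>i<d. a x i * (f x i)\<^sup>2)"
    by (simp add: Cons assms digit_prod_sum digit_prod_moment1 flip: sum_product)
  finally show ?case by simp
qed simp

section \<open>Typicality and Chebyshev's inequality\<close>

definition lg :: "real \<Rightarrow> real" where
  "lg t = (if 0 < t then log 2 t else 0)"

text \<open>\<open>lg\<close> is 0 at 0, where the true logarithm is minus infinity, so the
  exponential form fails at a vanishing weight. The support hypothesis excludes this at every index
  of nonzero \<open>a\<close>-weight.\<close>

lemma digit_prod_eq_powr_digit_sum:
  assumes "\<And>x i. i < d \<Longrightarrow> 0 \<le> w x i"
    and "\<And>x i. x \<in> set xs \<Longrightarrow> i < d \<Longrightarrow> w x i = 0 \<Longrightarrow> a x i = 0"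
  shows "i < d ^ length xs \<Longrightarrow> digit_prod d a xs i \<noteq> 0 \<Longrightarrow> digit_prod d w xs i = 2 powr digit_sum d (\<lambda>x i. lg (w x i)) xs i"
  using assms(2)
proof (induction xs arbitrary: i)
  case (Cons x xs)
  have i: "i < d * d ^ length xs" using Cons.prems by simp
  have "a x (i div d ^ length xs) \<noteq> 0" using Cons.prems by simp
  hence "w x (i div d ^ length xs) \<noteq> 0" using Cons.prems(3)[of x] div_mod_less[OF i] by fastforce
  hence "w x (i div d ^ length xs) > 0" using assms(1) div_mod_less[OF i] by (simp add: less_le)
  moreover have "digit_prod d w xs (i mod d ^ length xs) = 2 powr digit_sum d (\<lambda>x i. lg (w x i)) xs (i mod d ^ length xs)"
    by (rule Cons.IH) (use Cons.prems div_mod_less[OF i] in auto)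
  ultimately show ?case by (simp add: powr_add lg_def)
qed simp

lemma digit_sum_minus_const:
  "digit_sum d (\<lambda>x i. f x i - m x) xs i = digit_sum d f xs i - (\<Sum>x\<leftarrow>xs. m x)"
  by (induction xs arbitrary: i) auto

text \<open>In use, \<open>H\<close> is an expected logarithm, that is, minus an entropy, and
  \<open>t\<close> is the allowed deviation of the logarithm of \<open>w\<close>.\<close>

definition typ_ind :: "real \<Rightarrow> real \<Rightarrow> real \<Rightarrow> real" where
  "typ_ind H t w = (if 2 powr (H - t) \<le> w \<and> w \<le> 2 powr (H + t) then 1 else 0)"

text \<open>Two families are needed because \<rho> is measured both in its own eigenbasis, where
  \<open>a\<close> and \<open>w\<close> coincide, and in that of \<sigma>, where \<open>a\<close> is
  the outcome distribution and \<open>w\<close> the spectrum of \<sigma>.\<close>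

lemma digit_prod_chebyshev:
  assumes a0: "\<And>x i. i < d \<Longrightarrow> 0 \<le> a x i" and a1: "\<And>x. (\<Sum>i<d. a x i) = 1"
    and w0: "\<And>x i. i < d \<Longrightarrow> 0 \<le> w x i"
    and wa: "\<And>x i. x \<in> set xs \<Longrightarrow> i < d \<Longrightarrow> w x i = 0 \<Longrightarrow> a x i = 0"
    and t: "0 < t"
    and H: "H = (\<Sum>x\<leftarrow>xs. \<Sum>i<d. a x i * lg (w x i))"
  shows "(\<Sum>i<d ^ length xs. digit_prod d a xs i * (1 - typ_ind H t (digit_prod d w xs i)))
    \<le> (\<Sum>x\<leftarrow>xs. \<Sum>i<d. a x i * (lg (w x i))\<^sup>2) / t\<^sup>2"
proof -
  define m where "m x = (\<Sum>i<d. a x i * lg (w x i))" for x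
  define f where "f x i = lg (w x i) - m x" for x i
  have f0: "(\<Sum>i<d. a x i * f x i) = 0" for x
    by (simp add: f_def right_diff_distrib sum_subtractf a1 flip: m_def sum_distrib_right)
  \<comment> \<open>The raw second moment, unlike the variance, is linear in \<open>a\<close>, so
    averaging over a type can later replace \<open>a\<close> by its mean.\<close>
  have f2: "(\<Sum>i<d. a x i * (f x i)\<^sup>2) \<le> (\<Sum>i<d. a x i * (lg (w x i))\<^sup>2)" for x
  proof -
    have "(\<Sum>i<d. a x i * (f x i)\<^sup>2) = (\<Sum>i<d. a x i * (lg (w x i))\<^sup>2) - 2 * m x * (\<Sum>i<d. a x i * lg (w x i)) + (m x)\<^sup>2 * (\<Sum>i<d. a x i)"
      by (simp add: f_def power2_diff algebra_simps sum.distrib sum_subtractf sum_distrib_left sum_distrib_right)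
    also have "\<dots> = (\<Sum>i<d. a x i * (lg (w x i))\<^sup>2) - (m x)\<^sup>2"
      by (simp add: a1 power2_eq_square flip: m_def)
    finally show ?thesis by simp
  qed
  have "digit_prod d a xs i * (1 - typ_ind H t (digit_prod d w xs i)) \<le> digit_prod d a xs i * (digit_sum d f xs i)\<^sup>2 / t\<^sup>2"
    if i: "i < d ^ length xs" for i
  proof (cases "digit_prod d a xs i = 0 \<or> typ_ind H t (digit_prod d w xs i) = 1")
    case True
    thus ?thesis using digit_prod_nonneg[of d a, OF a0 i] by auto
  next
    case False
    hence bad: "\<not> (2 powr (H - t) \<le> digit_prod d w xs i \<and> digit_prod d w xs i \<le> 2 powr (H + t))"
      by (auto simp: typ_ind_def)
    have *: "digit_sum d f xs i = digit_sum d (\<lambda>x i. lg (w x i)) xs i - H"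
      unfolding f_def digit_sum_minus_const H m_def ..
    have "digit_prod d w xs i = 2 powr digit_sum d (\<lambda>x i. lg (w x i)) xs i"
      by (rule digit_prod_eq_powr_digit_sum[OF w0 wa i]) (use False in auto)
    also have "\<dots> = 2 powr (H + digit_sum d f xs i)" using * by simp
    finally have "\<bar>digit_sum d f xs i\<bar> > t" using bad by auto
    hence "t\<^sup>2 \<le> (digit_sum d f xs i)\<^sup>2" using t by (metis abs_le_square_iff abs_of_pos less_imp_le)
    hence "1 \<le> (digit_sum d f xs i)\<^sup>2 / t\<^sup>2" using t by simp
    hence "digit_prod d a xs i * 1 \<le> digit_prod d a xs i * ((digit_sum d f xs i)\<^sup>2 / t\<^sup>2)"
      using digit_prod_nonneg[of d a, OF a0 i] by (intro mult_left_mono) auto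
    moreover have "typ_ind H t (digit_prod d w xs i) = 0" using bad by (auto simp: typ_ind_def)
    ultimately show ?thesis by simp
  qed
  hence "(\<Sum>i<d ^ length xs. digit_prod d a xs i * (1 - typ_ind H t (digit_prod d w xs i)))
     \<le> (\<Sum>i<d ^ length xs. digit_prod d a xs i * (digit_sum d f xs i)\<^sup>2 / t\<^sup>2)"
    by (intro sum_mono) auto
  also have "\<dots> = (\<Sum>x\<leftarrow>xs. \<Sum>i<d. a x i * (f x i)\<^sup>2) / t\<^sup>2"
    unfolding sum_divide_distrib[symmetric] by (simp add: digit_prod_moment2[OF a1 f0])
  also have "\<dots> \<le> (\<Sum>x\<leftarrow>xs. \<Sum>i<d. a x i * (lg (w x i))\<^sup>2) / t\<^sup>2"
    by (intro divide_right_mono sum_list_mono f2) auto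
  finally show ?thesis .
qed

section \<open>Truncation by spectral projections\<close>

lemma mtrace_mult_lincomb:
  assumes B: "B \<in> carrier_mat n n" and v: "\<And>x. x \<in> T \<Longrightarrow> v x \<in> carrier_mat n n"
  shows "mtrace (B * mat n n (\<lambda>(i, j). \<Sum>x\<in>T. c x * v x $$ (i, j))) = (\<Sum>x\<in>T. c x * mtrace (B * v x))"
proof -
  have "mtrace (B * mat n n (\<lambda>(i, j). \<Sum>x\<in>T. c x * v x $$ (i, j))) =
     (\<Sum>i<n. \<Sum>j<n. \<Sum>x\<in>T. c x * (B $$ (i, j) * v x $$ (j, i)))"
    by (subst mtrace_mult[OF B]) (auto simp: sum_distrib_left mult_ac intro!: sum.cong)
  also have "\<dots> = (\<Sum>i<n. \<Sum>x\<in>T. \<Sum>j<n. c x * (B $$ (i, j) * v x $$ (j, i)))"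
    by (rule sum.cong[OF refl], rule sum.swap)
  also have "\<dots> = (\<Sum>x\<in>T. \<Sum>i<n. \<Sum>j<n. c x * (B $$ (i, j) * v x $$ (j, i)))"
    by (rule sum.swap)
  also have "\<dots> = (\<Sum>x\<in>T. c x * mtrace (B * v x))"
    by (rule sum.cong) (simp_all add: mtrace_mult[OF B v] sum_distrib_left)
  finally show ?thesis .
qed

lemma fro_dg_mult_dg:
  assumes T: "T \<in> carrier_mat n n"
  shows "fro (dg n f * T * dg n h) = (\<Sum>i<n. \<Sum>j<n. (f i)\<^sup>2 * (cmod (T $$ (i, j)))\<^sup>2 * (h j)\<^sup>2)"
proof -
  have "(dg n f * T * dg n h) $$ (i, j) = complex_of_real (f i) * T $$ (i, j) * complex_of_real (h j)"
    if "i < n" "j < n" for i j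
    using that T by (subst dg_mult_right_index[of _ n n]) (auto simp: dg_mult_left_index[OF T] simp del: index_mult_mat(1))
  thus ?thesis using T by (auto simp: fro_def norm_mult power_mult_distrib simp del: index_mult_mat(1) intro!: sum.cong)
qed

lemma sandwich_dg_add:
  assumes U: "U \<in> carrier_mat n n" and V: "V \<in> carrier_mat n n"
  shows "U * dg n f * mat_adjoint V + U * dg n h * mat_adjoint V = U * dg n (\<lambda>i. f i + h i) * mat_adjoint V"
proof (rule eq_matI)
  fix i j assume "i < dim_row (U * dg n (\<lambda>i. f i + h i) * mat_adjoint V)" "j < dim_col (U * dg n (\<lambda>i. f i + h i) * mat_adjoint V)"
  hence "i < n" "j < n" using U V by auto
  thus "(U * dg n f * mat_adjoint V + U * dg n h * mat_adjoint V) $$ (i, j) = (U * dg n (\<lambda>i. f i + h i) * mat_adjoint V) $$ (i, j)"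
    using U V by (simp add: sandwich_dg_index[OF U V] sum.distrib distrib_left distrib_right del: index_mult_mat(1))
qed (use U V in auto)

text \<open>For unitary \<open>U\<close> and \<open>V\<close> the squared moduli are the transition
  probabilities between the two bases, so the diagonal is the outcome distribution of a measurement
  in the basis \<open>U\<close>.\<close>

lemma compression_diag:
  assumes U: "U \<in> carrier_mat n n" and V: "V \<in> carrier_mat n n" and i: "i < n"
  shows "(mat_adjoint U * (V * dg n \<mu> * mat_adjoint V) * U) $$ (i, i)
    = complex_of_real (\<Sum>j<n. (cmod ((mat_adjoint U * V) $$ (i, j)))\<^sup>2 * \<mu> j)"
proof -
  let ?T = "mat_adjoint U * V"
  have "mat_adjoint U * (V * dg n \<mu> * mat_adjoint V) * U = ?T * dg n \<mu> * mat_adjoint ?T"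
    using U V by (simp add: adj_mult[of _ n n _ n] assoc_mult_mat[of _ n n _ n _ n])
  also have "\<dots> $$ (i, i) = complex_of_real (\<Sum>j<n. (cmod (?T $$ (i, j)))\<^sup>2 * \<mu> j)"
    using U V i
    by (subst sandwich_dg_index) (auto simp: complex_norm_square mult_ac simp flip: of_real_power simp del: index_mult_mat(1) intro!: sum.cong)
  finally show ?thesis .
qed

text \<open>A positive matrix splits into two square roots, each with squared Hilbert-Schmidt norm
  equal to the trace.\<close>

lemma mtrace_unitary_sandwich_le:
  assumes uS: "unitary n S" and uV: "unitary n V" and h: "\<And>i. i < n \<Longrightarrow> 0 \<le> h i"
  shows "cmod (mtrace (S * (V * dg n h * mat_adjoint V))) \<le> (\<Sum>i<n. h i)"
proof -
  note S = unitaryD[OF uS] and V = unitaryD[OF uV]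
  let ?r = "dg n (\<lambda>i. sqrt (h i))"
  have "dg n h = ?r * ?r" unfolding dg_mult_dg using h by (intro dg_cong) auto
  hence "S * (V * dg n h * mat_adjoint V) = (S * V * ?r) * (?r * mat_adjoint V)"
    using S V by (simp add: assoc_mult_mat[of _ n n _ n _ n])
  hence "cmod (mtrace (S * (V * dg n h * mat_adjoint V))) \<le> sqrt (fro (S * V * ?r)) * sqrt (fro (?r * mat_adjoint V))"
    using mtrace_mult_le_fro[of "S * V * ?r" n n "?r * mat_adjoint V"] S V by simp
  also have "\<dots> = (\<Sum>i<n. h i)"
    using h sum_nonneg[of "{..<n}" h]
    by (simp add: fro_unitary_left[OF unitary_mult[OF uS uV]] fro_unitary_right[OF unitary_adj[OF uV]] fro_dg)
  finally show ?thesis .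
qed

text \<open>The two projections do not commute, so they are put on different sides of
  \<open>\<rho> = V dg \<mu> V*\<close>; the result need not be Hermitian, as only traces against unitary matrices are
  estimated.\<close>

definition truncated :: "nat \<Rightarrow> complex mat \<Rightarrow> complex mat \<Rightarrow> (nat \<Rightarrow> real) \<Rightarrow> (nat \<Rightarrow> real) \<Rightarrow> (nat \<Rightarrow> real) \<Rightarrow> complex mat" where
  "truncated n U V \<mu> g g' = (U * dg n g * mat_adjoint U) * (V * dg n (\<lambda>j. \<mu> j * g' j) * mat_adjoint V)"

text \<open>A gentle-measurement estimate. The atypical part of \<rho> in its own basis is positive
  with small trace, so it enters linearly. What the projection for \<sigma> cuts off need not be
  positive and is bounded by Cauchy-Schwarz, so its outcome probability enters under a root.\<close>

lemma truncate_error: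
  assumes uS: "unitary n S" and uU: "unitary n U" and uV: "unitary n V"
    and \<mu>: "\<And>i. i < n \<Longrightarrow> 0 \<le> \<mu> i" and \<mu>1: "(\<Sum>i<n. \<mu> i) = 1"
    and g: "\<And>i. g i \<in> {0, 1}" and g': "\<And>i. g' i \<in> {0, 1}"
    and a: "\<And>i. i < n \<Longrightarrow> (mat_adjoint U * (V * dg n \<mu> * mat_adjoint V) * U) $$ (i, i) = complex_of_real (a i)"
  shows "cmod (mtrace (S * (V * dg n \<mu> * mat_adjoint V)) - mtrace (S * truncated n U V \<mu> g g'))
    \<le> (\<Sum>i<n. \<mu> i * (1 - g' i)) + sqrt (\<Sum>i<n. a i * (1 - g i))"
proof -
  note S = unitaryD[OF uS] and V = unitaryD[OF uV] and U = unitaryD[OF uU]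
  let ?R1 = "V * dg n (\<lambda>j. \<mu> j * (1 - g' j)) * mat_adjoint V"
  let ?R2 = "V * dg n (\<lambda>j. \<mu> j * g' j) * mat_adjoint V"
  let ?Q = "U * dg n (\<lambda>j. 1 - g j) * mat_adjoint U"
  let ?P = "U * dg n g * mat_adjoint U"
  let ?T = "mat_adjoint U * V"
  have R: "V * dg n \<mu> * mat_adjoint V = ?R1 + ?R2"
    unfolding sandwich_dg_add[OF V(1) V(1)] by (simp add: algebra_simps)
  have "?P + ?Q = 1\<^sub>m n" unfolding sandwich_dg_add[OF U(1) U(1)] using U by (simp add: dg_one)
  hence "?R2 = (?P + ?Q) * ?R2" using V by simp
  also have "\<dots> = ?P * ?R2 + ?Q * ?R2"
    using U V by (intro add_mult_distrib_mat[of _ n n _ _ n]) auto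
  finally have R2: "?R2 = ?P * ?R2 + ?Q * ?R2" .
  have "mtrace (S * (V * dg n \<mu> * mat_adjoint V)) = mtrace (S * ?R1) + mtrace (S * ?R2)"
    unfolding R using S V by (simp add: mult_add_distrib_mat[of _ n n _ n] mtrace_add[of _ n])
  also have "mtrace (S * ?R2) = mtrace (S * (?P * ?R2)) + mtrace (S * (?Q * ?R2))"
    by (subst R2) (use S V U in \<open>simp add: mult_add_distrib_mat[of _ n n _ n] mtrace_add[of _ n]\<close>)
  finally have eq: "mtrace (S * (V * dg n \<mu> * mat_adjoint V)) - mtrace (S * truncated n U V \<mu> g g')
      = mtrace (S * ?R1) + mtrace (S * (?Q * ?R2))" by (simp add: truncated_def)
  have g'01: "0 \<le> g' i \<and> g' i \<le> 1 \<and> (g' i)\<^sup>2 = g' i" for i using g'[of i] by auto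
  have g01: "0 \<le> g i \<and> g i \<le> 1 \<and> (1 - g i)\<^sup>2 = 1 - g i" for i using g[of i] by auto
  have b1: "cmod (mtrace (S * ?R1)) \<le> (\<Sum>i<n. \<mu> i * (1 - g' i))"
    by (rule mtrace_unitary_sandwich_le[OF uS uV]) (use \<mu> g'01 in auto)
  \<comment> \<open>The indicator \<open>g'\<close> stays with the right factor, whose norm is at
    most 1. The left factor then carries the square root of all of \<rho>, so its squared norm is
    exactly the rejected probability under \<open>a\<close>.\<close>
  have "dg n (\<lambda>j. \<mu> j * g' j) = dg n (\<lambda>j. sqrt (\<mu> j)) * dg n (\<lambda>j. sqrt (\<mu> j) * g' j)"
    unfolding dg_mult_dg using \<mu> by (intro dg_cong) auto
  hence "S * (?Q * ?R2) = (S * U * (dg n (\<lambda>j. 1 - g j) * ?T * dg n (\<lambda>j. sqrt (\<mu> j)))) * (dg n (\<lambda>j. sqrt (\<mu> j) * g' j) * mat_adjoint V)"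
    using S V U by (simp add: assoc_mult_mat[of _ n n _ n _ n])
  hence "cmod (mtrace (S * (?Q * ?R2))) \<le> sqrt (fro (S * U * (dg n (\<lambda>j. 1 - g j) * ?T * dg n (\<lambda>j. sqrt (\<mu> j)))))
      * sqrt (fro (dg n (\<lambda>j. sqrt (\<mu> j) * g' j) * mat_adjoint V))"
    using mtrace_mult_le_fro[of "S * U * (dg n (\<lambda>j. 1 - g j) * ?T * dg n (\<lambda>j. sqrt (\<mu> j)))" n n
        "dg n (\<lambda>j. sqrt (\<mu> j) * g' j) * mat_adjoint V"] S V U by simp
  also have "\<dots> \<le> sqrt (fro (S * U * (dg n (\<lambda>j. 1 - g j) * ?T * dg n (\<lambda>j. sqrt (\<mu> j))))) * 1"
  proof (rule mult_left_mono)
    have "fro (dg n (\<lambda>j. sqrt (\<mu> j) * g' j) * mat_adjoint V) = (\<Sum>j<n. \<mu> j * g' j)"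
      using \<mu> g'01 by (simp add: fro_unitary_right[OF unitary_adj[OF uV]] fro_dg power_mult_distrib)
    also have "\<dots> \<le> (\<Sum>j<n. \<mu> j)" using \<mu> g'01 by (intro sum_mono) (simp add: mult_left_le)
    finally show "sqrt (fro (dg n (\<lambda>j. sqrt (\<mu> j) * g' j) * mat_adjoint V)) \<le> 1" using \<mu>1 by simp
  qed (simp add: fro_nonneg)
  also have "fro (S * U * (dg n (\<lambda>j. 1 - g j) * ?T * dg n (\<lambda>j. sqrt (\<mu> j))))
      = (\<Sum>i<n. \<Sum>j<n. (1 - g i)\<^sup>2 * (cmod (?T $$ (i, j)))\<^sup>2 * (sqrt (\<mu> j))\<^sup>2)"
    using U V by (simp add: fro_unitary_left[OF unitary_mult[OF uS uU]] fro_dg_mult_dg[of _ n] del: index_mult_mat(1))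
  also have "\<dots> = (\<Sum>i<n. (1 - g i) * (\<Sum>j<n. (cmod (?T $$ (i, j)))\<^sup>2 * \<mu> j))"
    unfolding sum_distrib_left by (intro sum.cong) (use \<mu> g01 in \<open>auto simp del: index_mult_mat(1)\<close>)
  also have "\<dots> = (\<Sum>i<n. a i * (1 - g i))"
  proof (rule sum.cong)
    fix i assume "i \<in> {..<n}"
    hence "complex_of_real (a i) = complex_of_real (\<Sum>j<n. (cmod (?T $$ (i, j)))\<^sup>2 * \<mu> j)"
      using a[of i] compression_diag[OF U(1) V(1), of i \<mu>] by simp
    hence "a i = (\<Sum>j<n. (cmod (?T $$ (i, j)))\<^sup>2 * \<mu> j)" unfolding of_real_eq_iff .
    thus "(1 - g i) * (\<Sum>j<n. (cmod (?T $$ (i, j)))\<^sup>2 * \<mu> j) = a i * (1 - g i)" by simp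
  qed simp
  finally have b2: "cmod (mtrace (S * (?Q * ?R2))) \<le> sqrt (\<Sum>i<n. a i * (1 - g i))" by simp
  show ?thesis unfolding eq using norm_triangle_ineq[of "mtrace (S * ?R1)" "mtrace (S * (?Q * ?R2))"] b1 b2 by linarith
qed

text \<open>Up to the unitary \<open>U\<close>, this is \<open>\<sigma>\<^sup>-\<^sup>1\<^sup>/\<^sup>2\<close> times the truncated state, where \<open>\<sigma> = U dg l U*\<close>.\<close>

definition reduced :: "nat \<Rightarrow> complex mat \<Rightarrow> (nat \<Rightarrow> real) \<Rightarrow> complex mat \<Rightarrow> (nat \<Rightarrow> real) \<Rightarrow> (nat \<Rightarrow> real) \<Rightarrow> (nat \<Rightarrow> real) \<Rightarrow> complex mat" where
  "reduced n U l V \<mu> g g' =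
     dg n (\<lambda>i. g i / sqrt (l i)) * (mat_adjoint U * V) * dg n (\<lambda>j. \<mu> j * g' j) * mat_adjoint V"

lemma reduced_carrier [simp]:
  "U \<in> carrier_mat n n \<Longrightarrow> V \<in> carrier_mat n n \<Longrightarrow> reduced n U l V \<mu> g g' \<in> carrier_mat n n"
  by (simp add: reduced_def)

text \<open>Inserting \<open>\<sigma>\<^sup>1\<^sup>/\<^sup>2\<close> and its inverse is sound on
  the range of the projection, where the eigenvalues are positive.\<close>

lemma truncate_eq_reduced:
  assumes U: "U \<in> carrier_mat n n" and V: "V \<in> carrier_mat n n"
    and g: "\<And>i. g i \<in> {0, 1}" and l: "\<And>i. i < n \<Longrightarrow> g i = 1 \<Longrightarrow> 0 < l i"
  shows "truncated n U V \<mu> g g' = U * dg n (\<lambda>i. g i * sqrt (l i)) * reduced n U l V \<mu> g g'"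
proof -
  have "g i = (g i * sqrt (l i)) * (g i / sqrt (l i))" if "i < n" for i using g[of i] l[OF that] by auto
  hence "dg n g = dg n (\<lambda>i. g i * sqrt (l i)) * dg n (\<lambda>i. g i / sqrt (l i))"
    unfolding dg_mult_dg by (rule dg_cong)
  thus ?thesis using U V by (simp add: truncated_def reduced_def assoc_mult_mat[of _ n n _ n _ n])
qed

text \<open>The inverse of \<sigma> contributes at most 1 / \<alpha> on its typical subspace. Of the
  two powers of \<mu>, one is absorbed by \<beta> and the other sums to the trace of \<rho>, which
  is 1.\<close>

lemma fro_reduced_le:
  assumes uU: "unitary n U" and uV: "unitary n V"
    and \<mu>: "\<And>i. i < n \<Longrightarrow> 0 \<le> \<mu> i" and \<mu>1: "(\<Sum>i<n. \<mu> i) = 1"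
    and g: "\<And>i. g i \<in> {0, 1}" and g': "\<And>i. g' i \<in> {0, 1}"
    and \<alpha>: "0 < \<alpha>" "\<And>i. i < n \<Longrightarrow> g i = 1 \<Longrightarrow> \<alpha> \<le> l i"
    and \<beta>: "0 \<le> \<beta>" "\<And>i. i < n \<Longrightarrow> g' i = 1 \<Longrightarrow> \<mu> i \<le> \<beta>"
  shows "fro (reduced n U l V \<mu> g g') \<le> \<beta> / \<alpha>"
proof -
  note V = unitaryD[OF uV] and U = unitaryD[OF uU]
  let ?T = "mat_adjoint U * V"
  have uT: "unitary n ?T" by (rule unitary_mult[OF unitary_adj[OF uU] uV])
  have T: "?T \<in> carrier_mat n n" using U V by simp
  have "fro (reduced n U l V \<mu> g g') = (\<Sum>i<n. \<Sum>j<n. (g i / sqrt (l i))\<^sup>2 * (cmod (?T $$ (i, j)))\<^sup>2 * (\<mu> j * g' j)\<^sup>2)"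
    using U V T unfolding reduced_def
    by (simp add: fro_unitary_right[OF unitary_adj[OF uV]] fro_dg_mult_dg[OF T] del: index_mult_mat(1))
  also have "\<dots> \<le> (\<Sum>i<n. \<Sum>j<n. (1 / \<alpha>) * (cmod (?T $$ (i, j)))\<^sup>2 * (\<beta> * \<mu> j))"
  proof (intro sum_mono mult_mono)
    fix i j assume "i \<in> {..<n}" "j \<in> {..<n}"
    hence i: "i < n" and j: "j < n" by auto
    show "(g i / sqrt (l i))\<^sup>2 \<le> 1 / \<alpha>"
      using g[of i] \<alpha>(1) \<alpha>(2)[OF i] by (auto simp: power_divide intro!: divide_left_mono)
    show "(\<mu> j * g' j)\<^sup>2 \<le> \<beta> * \<mu> j"
      using g'[of j] \<beta>(1) \<beta>(2)[OF j] \<mu>[OF j] by (auto simp: power2_eq_square intro!: mult_right_mono)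
  qed (use \<alpha> \<mu> in auto)
  also have "\<dots> = \<beta> / \<alpha> * (\<Sum>i<n. \<Sum>j<n. 1\<^sup>2 * (cmod (?T $$ (i, j)))\<^sup>2 * (sqrt (\<mu> j))\<^sup>2)"
    unfolding sum_distrib_left by (intro sum.cong) (use \<mu> in \<open>auto simp del: index_mult_mat(1)\<close>)
  also have "(\<Sum>i<n. \<Sum>j<n. 1\<^sup>2 * (cmod (?T $$ (i, j)))\<^sup>2 * (sqrt (\<mu> j))\<^sup>2) = fro (?T * dg n (\<lambda>j. sqrt (\<mu> j)))"
    using fro_dg_mult_dg[OF T, of "\<lambda>_. 1" "\<lambda>j. sqrt (\<mu> j)"] left_mult_one_mat[OF T] by (simp only: dg_one)
  also have "\<dots> = 1" unfolding fro_unitary_left[OF uT dg_carrier] fro_dg using \<mu> \<mu>1 by simp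
  finally show ?thesis by simp
qed

text \<open>The squared Hilbert-Schmidt norm of the factor in front of \<open>X\<close> is at most
  the trace of \<sigma>, whatever \<open>S\<close> is: here the trace norm is traded for a Hilbert
  norm.\<close>

lemma mtrace_unitary_mult_le_fro:
  assumes uS: "unitary n S" and uU: "unitary n U" and X: "X \<in> carrier_mat n n"
    and l: "\<And>i. i < n \<Longrightarrow> 0 \<le> l i" "(\<Sum>i<n. l i) = 1" and g: "\<And>i. g i \<in> {0, 1}"
  shows "cmod (mtrace (S * (U * dg n (\<lambda>i. g i * sqrt (l i))) * X)) \<le> sqrt (fro X)"
proof -
  note S = unitaryD[OF uS] and U = unitaryD[OF uU]
  let ?B = "S * (U * dg n (\<lambda>i. g i * sqrt (l i)))"
  have "cmod (mtrace (?B * X)) \<le> sqrt (fro ?B) * sqrt (fro X)"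
    by (rule mtrace_mult_le_fro[of _ n n]) (use S U X in auto)
  also have "\<dots> \<le> 1 * sqrt (fro X)"
  proof (rule mult_right_mono)
    have "fro ?B = (\<Sum>i<n. (g i * sqrt (l i))\<^sup>2)"
      using U by (simp add: fro_unitary_left[OF uS] fro_unitary_left[OF uU] fro_dg)
    also have "\<dots> \<le> (\<Sum>i<n. l i)"
    proof (rule sum_mono)
      fix i assume "i \<in> {..<n}"
      thus "(g i * sqrt (l i))\<^sup>2 \<le> l i" using g[of i] l(1)[of i] by auto
    qed
    finally show "sqrt (fro ?B) \<le> 1" using l(2) by simp
  qed (simp add: fro_nonneg)
  finally show ?thesis by simp
qed

section \<open>Approximation by empirical averages\<close>

lemma weighted_average_le_imp_ex:
  fixes p f :: "'a \<Rightarrow> real"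
  assumes X: "finite X" and p: "\<And>x. x \<in> X \<Longrightarrow> 0 \<le> p x" "sum p X = 1"
    and le: "(\<Sum>x\<in>X. p x * f x) \<le> K"
  obtains x where "x \<in> X" "f x \<le> K"
proof (rule ccontr)
  assume "\<not> thesis"
  hence gt: "K < f x" if "x \<in> X" for x using that \<open>\<And>x. x \<in> X \<Longrightarrow> f x \<le> K \<Longrightarrow> thesis\<close> by force
  obtain y where y: "y \<in> X" "p y > 0" using p
    by (metis less_eq_real_def sum.neutral zero_neq_one)
  have "(\<Sum>x\<in>X. p x * K) < (\<Sum>x\<in>X. p x * f x)"
    by (rule sum_strict_mono_ex1[OF X]) (use gt y p in \<open>auto intro!: mult_left_mono bexI[of _ y] simp: less_imp_le\<close>)
  moreover have "(\<Sum>x\<in>X. p x * K) = K" using p(2) by (simp flip: sum_distrib_right)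
  ultimately show False using le by simp
qed

text \<open>The cross term with a centred step has mean zero, so the step raises the mean squared
  length by its variance, which is at most its second moment.\<close>

lemma shifted_second_moment_le:
  fixes v :: "'a \<Rightarrow> complex"
  assumes "sum p X = 1"
  shows "(\<Sum>x\<in>X. p x * (cmod (s + (v x - (\<Sum>y\<in>X. of_real (p y) * v y))))\<^sup>2) \<le> (cmod s)\<^sup>2 + (\<Sum>x\<in>X. p x * (cmod (v x))\<^sup>2)"
proof -
  define m where "m = (\<Sum>y\<in>X. of_real (p y) * v y)"
  have sq: "(cmod (s + (w - m)))\<^sup>2 = (cmod (s - m))\<^sup>2 + (cmod w)\<^sup>2 + 2 * Re (cnj (s - m) * w)" for w
    by (simp add: cmod_power2) (simp add: power2_eq_square algebra_simps)
  have "(\<Sum>x\<in>X. p x * (cmod (s + (v x - m)))\<^sup>2) = (cmod (s - m))\<^sup>2 * sum p X + (\<Sum>x\<in>X. p x * (cmod (v x))\<^sup>2)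
      + 2 * (\<Sum>x\<in>X. p x * Re (cnj (s - m) * v x))"
    unfolding sq by (simp add: distrib_left sum.distrib sum_distrib_left sum_distrib_right mult_ac)
  also have "(\<Sum>x\<in>X. p x * Re (cnj (s - m) * v x)) = Re (cnj (s - m) * m)"
    unfolding m_def sum_distrib_left Re_sum by (intro sum.cong refl) (simp add: algebra_simps)
  also have "(cmod (s - m))\<^sup>2 * sum p X + (\<Sum>x\<in>X. p x * (cmod (v x))\<^sup>2) + 2 * Re (cnj (s - m) * m)
     = (cmod s)\<^sup>2 + (\<Sum>x\<in>X. p x * (cmod (v x))\<^sup>2) - (cmod m)\<^sup>2"
    using assms by (simp add: cmod_power2) (simp add: power2_eq_square algebra_simps)
  finally show ?thesis unfolding m_def[symmetric] by simp
qed

text \<open>Maurey's empirical method, derandomised: the points are picked one at a time, each of them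
  keeping the squared distance below its conditional expectation.\<close>

lemma maurey_list:
  fixes v :: "'a \<Rightarrow> 'i \<Rightarrow> complex"
  assumes X: "finite X" and I: "finite I" and p: "\<And>x. x \<in> X \<Longrightarrow> 0 \<le> p x" "sum p X = 1"
    and B: "\<And>x. x \<in> X \<Longrightarrow> (\<Sum>i\<in>I. (cmod (v x i))\<^sup>2) \<le> B"
  shows "\<exists>xs. length xs = M \<and> set xs \<subseteq> X \<and>
    (\<Sum>i\<in>I. (cmod ((\<Sum>x\<leftarrow>xs. v x i) - of_nat M * (\<Sum>y\<in>X. of_real (p y) * v y i)))\<^sup>2) \<le> real M * B"
proof (induction M)
  case 0
  thus ?case by simp
next
  case (Suc M)
  define m where "m i = (\<Sum>y\<in>X. of_real (p y) * v y i)" for i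
  from Suc obtain xs where xs: "length xs = M" "set xs \<subseteq> X"
    and le: "(\<Sum>i\<in>I. (cmod ((\<Sum>x\<leftarrow>xs. v x i) - of_nat M * m i))\<^sup>2) \<le> real M * B"
    unfolding m_def by blast
  define s where "s i = (\<Sum>x\<leftarrow>xs. v x i) - of_nat M * m i" for i
  have "(\<Sum>x\<in>X. p x * (\<Sum>i\<in>I. (cmod (s i + (v x i - m i)))\<^sup>2)) = (\<Sum>i\<in>I. \<Sum>x\<in>X. p x * (cmod (s i + (v x i - m i)))\<^sup>2)"
    unfolding sum_distrib_left by (rule sum.swap)
  also have "\<dots> \<le> (\<Sum>i\<in>I. (cmod (s i))\<^sup>2 + (\<Sum>x\<in>X. p x * (cmod (v x i))\<^sup>2))"
    unfolding m_def by (intro sum_mono shifted_second_moment_le p)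
  also have "\<dots> = (\<Sum>i\<in>I. (cmod (s i))\<^sup>2) + (\<Sum>x\<in>X. p x * (\<Sum>i\<in>I. (cmod (v x i))\<^sup>2))"
    unfolding sum.distrib sum_distrib_left by (subst sum.swap) simp
  also have "\<dots> \<le> real M * B + (\<Sum>x\<in>X. p x * B)"
    by (intro add_mono sum_mono mult_left_mono B p) (use le in \<open>auto simp: s_def\<close>)
  also have "\<dots> = real (Suc M) * B" unfolding sum_distrib_right[symmetric] p(2) by (simp add: algebra_simps)
  finally have avg: "(\<Sum>x\<in>X. p x * (\<Sum>i\<in>I. (cmod (s i + (v x i - m i)))\<^sup>2)) \<le> real (Suc M) * B" .
  obtain x where x: "x \<in> X" "(\<Sum>i\<in>I. (cmod (s i + (v x i - m i)))\<^sup>2) \<le> real (Suc M) * B"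
    using weighted_average_le_imp_ex[OF X p(1) p(2) avg] by metis
  have "(\<Sum>i\<in>I. (cmod ((\<Sum>x\<leftarrow>x # xs. v x i) - of_nat (Suc M) * m i))\<^sup>2) \<le> real (Suc M) * B"
    using x(2) by (simp add: s_def algebra_simps)
  thus ?case unfolding m_def using xs x(1) by (intro exI[of _ "x # xs"]) auto
qed

lemma sum_list_map_eq_sum_count_list:
  fixes f :: "'a \<Rightarrow> 'b::semiring_1"
  assumes "finite X" "set xs \<subseteq> X"
  shows "(\<Sum>x\<leftarrow>xs. f x) = (\<Sum>x\<in>X. of_nat (count_list xs x) * f x)"
  using assms(2)
proof (induction xs)
  case (Cons y xs)
  have "(\<Sum>x\<in>X. of_nat (count_list (y # xs) x) * f x) = (\<Sum>x\<in>X. (if x = y then f y else 0) + of_nat (count_list xs x) * f x)"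
    by (rule sum.cong) (auto simp: distrib_right)
  also have "\<dots> = f y + (\<Sum>x\<in>X. of_nat (count_list xs x) * f x)"
    using assms(1) Cons.prems by (simp add: sum.distrib)
  finally show ?case using Cons by simp
qed simp

lemma finite_words [simp]: "finite (words n :: 'x::finite list set)"
  unfolding words_def using finite_lists_length_eq[of "UNIV :: 'x set" n] by simp

lemma count_list_distr_M:
  fixes ys :: "'x::finite list list"
  assumes "length ys = M" "set ys \<subseteq> words n" "0 < M"
  shows "(\<lambda>x. real (count_list ys x) / real M) \<in> distr_M M n"
proof -
  have "(\<Sum>x\<in>words n. real (count_list ys x)) = real M"
    using sum_list_map_eq_sum_count_list[OF finite_words assms(2), of "\<lambda>_. 1::real"] assms(1) by (simp add: sum_list_triv)
  hence "(\<Sum>x\<in>words n. real (count_list ys x) / real M) = 1"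
    using assms(3) by (simp flip: sum_divide_distrib)
  moreover have "count_list ys x = 0" if "x \<notin> words n" for x using that assms(2) by (auto simp: count_list_0_iff)
  ultimately show ?thesis using assms(3) by (auto simp: distr_M_def distr_def)
qed

text \<open>Passing from a sum over \<open>M\<close> words to their average divides the squared
  error \<open>M * B\<close> by the square of \<open>M\<close>. The integers \<open>M * q x\<close>
  are the multiplicities in the list.\<close>

lemma maurey_distr_M:
  fixes v :: "'x::finite list \<Rightarrow> 'i \<Rightarrow> complex"
  assumes I: "finite I" and p: "p \<in> distr (words n)" and M: "0 < M"
    and B: "\<And>x. x \<in> words n \<Longrightarrow> (\<Sum>i\<in>I. (cmod (v x i))\<^sup>2) \<le> B"
  shows "\<exists>q\<in>distr_M M n. (\<Sum>i\<in>I. (cmod (\<Sum>x\<in>words n. of_real (p x - q x) * v x i))\<^sup>2) \<le> B / real M"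
proof -
  from maurey_list[OF finite_words I, of n p v B M] p B
  obtain ys where ys: "length ys = M" "set ys \<subseteq> words n" and
    le: "(\<Sum>i\<in>I. (cmod ((\<Sum>x\<leftarrow>ys. v x i) - of_nat M * (\<Sum>y\<in>words n. of_real (p y) * v y i)))\<^sup>2) \<le> real M * B"
    by (auto simp: distr_def)
  define q where "q x = real (count_list ys x) / real M" for x
  have "q \<in> distr_M M n" unfolding q_def by (rule count_list_distr_M[OF ys M])
  moreover have "(\<Sum>i\<in>I. (cmod (\<Sum>x\<in>words n. of_real (p x - q x) * v x i))\<^sup>2) \<le> B / real M"
  proof -
    have "(cmod ((\<Sum>x\<leftarrow>ys. v x i) - of_nat M * (\<Sum>y\<in>words n. of_real (p y) * v y i)))\<^sup>2
       = (real M)\<^sup>2 * (cmod (\<Sum>x\<in>words n. of_real (p x - q x) * v x i))\<^sup>2" for i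
    proof -
      have "(\<Sum>x\<leftarrow>ys. v x i) = of_nat M * (\<Sum>x\<in>words n. of_real (q x) * v x i)"
        unfolding sum_list_map_eq_sum_count_list[OF finite_words ys(2)] sum_distrib_left q_def using M by simp
      hence "(\<Sum>x\<leftarrow>ys. v x i) - of_nat M * (\<Sum>y\<in>words n. of_real (p y) * v y i)
         = - (of_nat M * (\<Sum>x\<in>words n. of_real (p x - q x) * v x i))"
        by (simp add: algebra_simps sum_subtractf)
      thus ?thesis by (simp add: norm_mult power_mult_distrib)
    qed
    with le have "(real M)\<^sup>2 * (\<Sum>i\<in>I. (cmod (\<Sum>x\<in>words n. of_real (p x - q x) * v x i))\<^sup>2) \<le> real M * B"
      by (simp flip: sum_distrib_left)
    thus ?thesis using M by (simp add: power2_eq_square field_simps)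
  qed
  ultimately show ?thesis by blast
qed

section \<open>The number of types and logarithmic moments\<close>

lemma card_types_le:
  "finite (count_list ` (words n :: 'x::finite list set))"
  "card (count_list ` (words n :: 'x::finite list set)) \<le> (n + 1) ^ card (UNIV :: 'x set)"
proof -
  have fin: "finite (PiE (UNIV::'x set) (\<lambda>_. {..n}))" by (rule finite_PiE) auto
  have sub: "count_list ` (words n :: 'x list set) \<subseteq> PiE UNIV (\<lambda>_. {..n})"
    by (auto simp: words_def count_le_length)
  show "finite (count_list ` (words n :: 'x list set))" by simp
  have "card (PiE (UNIV::'x set) (\<lambda>_. {..n})) = (n + 1) ^ card (UNIV :: 'x set)" by (simp add: card_PiE)
  thus "card (count_list ` (words n :: 'x list set)) \<le> (n + 1) ^ card (UNIV :: 'x set)"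
    using card_mono[OF fin sub] by simp
qed

text \<open>The bounds do not depend on how small the eigenvalues are, which makes the Chebyshev
  error uniform over types and words. They come from \<open>ln x \<le> x - 1\<close> at x = 1 / s;
  for the second moment, t times the square of ln t is 4 times the square of s ln s with s = sqrt
  t.\<close>

lemma mult_lg_bounds:
  assumes "0 \<le> t" "t \<le> 1"
  shows "lg t \<le> 0" "- (t * lg t) \<le> 1 / ln 2" "t * (lg t)\<^sup>2 \<le> 4 / (ln 2)\<^sup>2"
proof -
  have *: "0 \<le> - (s * ln s) \<and> - (s * ln s) \<le> 1" if "0 < s" "s \<le> 1" for s :: real
  proof -
    have "ln (1 / s) \<le> 1 / s - 1" using ln_le_minus_one[of "1 / s"] that by simp
    hence "s * ln (1 / s) \<le> s * (1 / s - 1)" using that by (intro mult_left_mono) auto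
    moreover have "s * (1 / s - 1) = 1 - s" using that by (simp add: right_diff_distrib)
    moreover have "ln s \<le> 0" using that by simp
    ultimately show ?thesis using that by (simp add: ln_div mult_nonneg_nonpos)
  qed
  show "lg t \<le> 0" using assms by (simp add: lg_def)
  show "- (t * lg t) \<le> 1 / ln 2" using *[of t] assms by (auto simp: lg_def log_def field_simps)
  show "t * (lg t)\<^sup>2 \<le> 4 / (ln 2)\<^sup>2"
  proof (cases "t = 0")
    case False
    hence t: "0 < t" using assms by simp
    let ?s = "sqrt t"
    have s: "0 \<le> - (?s * ln ?s) \<and> - (?s * ln ?s) \<le> 1" using t assms by (intro *) auto
    hence "(?s * ln ?s)\<^sup>2 \<le> 1" by (simp add: abs_square_le_1)
    hence "t * (ln t)\<^sup>2 \<le> 4" using t by (simp add: power_mult_distrib ln_sqrt power_divide)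
    thus ?thesis using t by (simp add: lg_def log_def power_divide divide_right_mono)
  qed simp
qed

section \<open>Output states and mutual information\<close>

lemma compression_lincomb:
  fixes U :: "complex mat"
  assumes U: "U \<in> carrier_mat n n" and v: "\<And>x. x \<in> T \<Longrightarrow> v x \<in> carrier_mat n n" and k: "k < n"
  shows "(mat_adjoint U * mat n n (\<lambda>(i, j). \<Sum>x\<in>T. c x * v x $$ (i, j)) * U) $$ (k, k)
    = (\<Sum>x\<in>T. c x * (mat_adjoint U * v x * U) $$ (k, k))"
proof -
  \<comment> \<open>A diagonal entry of the compression is a trace against the rank-one matrix built
    from column \<open>k\<close> of \<open>U\<close>, so linearity of the trace suffices.\<close>
  let ?E = "U * dg n (\<lambda>i. if i = k then 1 else 0) * mat_adjoint U"
  have E: "?E \<in> carrier_mat n n" using U by simp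
  have *: "(mat_adjoint U * A * U) $$ (k, k) = mtrace (?E * A)" if A: "A \<in> carrier_mat n n" for A
  proof -
    have "mtrace (?E * A) = mtrace (A * ?E)" by (rule mtrace_cyclic[OF E A])
    also have "\<dots> = (\<Sum>i<n. if i = k then (mat_adjoint U * A * U) $$ (k, k) else 0)"
      unfolding mtrace_mult_sandwich_dg[OF A U] by (rule sum.cong) (auto simp del: index_mult_mat(1))
    finally show ?thesis using k by simp
  qed
  show ?thesis by (simp add: * mtrace_mult_lincomb[OF E v] v del: index_mult_mat(1))
qed

lemma density_spectral:
  assumes "density d \<rho>"
  shows "\<exists>V \<mu>. unitary d V \<and> \<rho> = V * dg d \<mu> * mat_adjoint V \<and> (\<forall>i<d. 0 \<le> \<mu> i) \<and> (\<Sum>i<d. \<mu> i) = 1"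
proof -
  have \<rho>: "\<rho> \<in> carrier_mat d d" and psd: "psd \<rho>" and tr: "mtrace \<rho> = 1" using assms by (auto simp: density_def)
  hence herm: "mat_adjoint \<rho> = \<rho>" by (auto simp: psd_def hermitian_def)
  obtain V \<mu> where u: "unitary d V" and eq: "\<rho> = V * dg d \<mu> * mat_adjoint V" using hermitian_spectral[OF \<rho> herm] by blast
  note V = unitaryD[OF u]
  have "0 \<le> \<mu> i" if i: "i < d" for i
  proof -
    have "\<rho> * V = V * dg d \<mu>" unfolding eq using V by (simp add: assoc_mult_mat[of _ d d _ d _ d])
    hence "\<rho> *\<^sub>v col V i = col (V * dg d \<mu>) i" using \<rho> V i by (subst col_mult2[symmetric, of _ d d _ d]) auto
    also have "\<dots> = complex_of_real (\<mu> i) \<cdot>\<^sub>v col V i"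
      using V i by (intro eq_vecI) (auto simp: dg_mult_right_index[OF V(1)] mult.commute simp del: index_mult_mat(1))
    finally have ev: "\<rho> *\<^sub>v col V i = complex_of_real (\<mu> i) \<cdot>\<^sub>v col V i" .
    have "conjugate (col V i) \<bullet> col V i = (mat_adjoint V * V) $$ (i, i)"
      unfolding mult_index[OF V(2) V(1) i i] scalar_prod_def using V i by (auto simp: lessThan_atLeast0 intro!: sum.cong)
    also have "\<dots> = 1" using V i by simp
    finally have "conjugate (col V i) \<bullet> (\<rho> *\<^sub>v col V i) = complex_of_real (\<mu> i)"
      unfolding ev using V i by simp
    moreover have "0 \<le> Re (conjugate (col V i) \<bullet> (\<rho> *\<^sub>v col V i))"
      using psd \<rho> V i by (auto simp: psd_def)
    ultimately show ?thesis by simp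
  qed
  moreover have "(\<Sum>i<d. \<mu> i) = 1" using tr mtrace_sandwich_dg[OF u, of \<mu>] unfolding eq by (metis of_real_eq_1_iff)
  ultimately show ?thesis using u eq by blast
qed

lemma cq_out_n_hermitian:
  assumes "\<And>x. W x \<in> carrier_mat d d" "\<And>x. mat_adjoint (W x) = W x"
  shows "mat_adjoint (cq_out_n d W n p) = cq_out_n d W n p"
proof (rule eq_matI)
  fix i j assume "i < dim_row (cq_out_n d W n p)" "j < dim_col (cq_out_n d W n p)"
  hence ij: "i < d ^ n" "j < d ^ n" by (auto simp: cq_out_n_def)
  have "cnj (tensor_list (map W xs) $$ (j, i)) = tensor_list (map W xs) $$ (i, j)" if "xs \<in> words n" for xs
  proof -
    have "mat_adjoint (tensor_list (map W xs)) = tensor_list (map W xs)"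
      using tensor_list_adj[of W d xs, OF assms(1)] assms(2) by simp
    moreover have "tensor_list (map W xs) \<in> carrier_mat (d ^ n) (d ^ n)"
      using tensor_list_carrier[of W d xs, OF assms(1)] that by (simp add: words_def)
    ultimately show ?thesis using ij adj_index[of i "tensor_list (map W xs)" j] by auto
  qed
  thus "mat_adjoint (cq_out_n d W n p) $$ (i, j) = cq_out_n d W n p $$ (i, j)"
    using ij by (auto simp: cq_out_n_def intro!: sum.cong)
qed (auto simp: cq_out_n_def)

text \<open>The eigenbasis of the output state \<open>W(p)\<close>; \<open>a x\<close> is the distribution of the outcome when
  \<open>W x\<close> is measured in that basis, so that the spectrum of \<open>W(p)\<close> is the \<open>p\<close>-average of the \<open>a x\<close>.\<close>

lemma cq_out_spectral:
  fixes W :: "'x::finite \<Rightarrow> complex mat"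
  assumes V: "\<And>x. unitary d (V x)" and W: "\<And>x. W x = V x * dg d (\<mu> x) * mat_adjoint (V x)"
    and \<mu>0: "\<And>x i. i < d \<Longrightarrow> 0 \<le> \<mu> x i" and \<mu>1: "\<And>x. (\<Sum>i<d. \<mu> x i) = 1"
    and p: "p \<in> distr UNIV"
  obtains U l a where "unitary d U" "cq_out d W p = U * dg d l * mat_adjoint U"
    "\<And>x i. i < d \<Longrightarrow> (mat_adjoint U * W x * U) $$ (i, i) = complex_of_real (a x i)"
    "\<And>x i. i < d \<Longrightarrow> 0 \<le> a x i" "\<And>x. (\<Sum>i<d. a x i) = 1"
    "\<And>i. i < d \<Longrightarrow> l i = (\<Sum>x\<in>UNIV. p x * a x i)"
    "\<And>i. i < d \<Longrightarrow> 0 \<le> l i" "(\<Sum>i<d. l i) = 1"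
    "\<And>x. rel_entropy (W x) (cq_out d W p) = (\<Sum>i<d. \<mu> x i * lg (\<mu> x i)) - (\<Sum>i<d. a x i * lg (l i))"
    "mutual_info d W p = (\<Sum>x\<in>UNIV. p x * (\<Sum>i<d. \<mu> x i * lg (\<mu> x i))) - (\<Sum>i<d. l i * lg (l i))"
proof -
  have Wc: "W x \<in> carrier_mat d d" for x using unitaryD[OF V] by (simp add: W)
  have Wh: "mat_adjoint (W x) = W x" for x unfolding W by (rule sandwich_dg_adj[OF unitaryD(1)[OF V]])
  let ?\<sigma> = "cq_out d W p"
  have \<sigma>: "?\<sigma> \<in> carrier_mat d d" by (simp add: cq_out_def)
  have "mat_adjoint ?\<sigma> = ?\<sigma>"
  proof (rule eq_matI)
    fix i j assume "i < dim_row ?\<sigma>" "j < dim_col ?\<sigma>"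
    hence ij: "i < d" "j < d" by (auto simp: cq_out_def)
    have "cnj (W x $$ (j, i)) = W x $$ (i, j)" for x
      using ij adj_index[of i "W x" j] Wc[of x] Wh[of x] by auto
    thus "mat_adjoint ?\<sigma> $$ (i, j) = ?\<sigma> $$ (i, j)" using ij by (auto simp: cq_out_def intro!: sum.cong)
  qed (auto simp: cq_out_def)
  then obtain U l where uU: "unitary d U" and \<sigma>U: "?\<sigma> = U * dg d l * mat_adjoint U"
    using hermitian_spectral[OF \<sigma>] by blast
  note U = unitaryD[OF uU]
  define a where "a x i = (\<Sum>j<d. (cmod ((mat_adjoint U * V x) $$ (i, j)))\<^sup>2 * \<mu> x j)" for x i
  have a: "(mat_adjoint U * W x * U) $$ (i, i) = complex_of_real (a x i)" if "i < d" for x i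
    unfolding W a_def by (rule compression_diag[OF U(1) unitaryD(1)[OF V] that])
  have a0: "0 \<le> a x i" for x i unfolding a_def using \<mu>0 by (intro sum_nonneg) auto
  have tr_W: "mtrace (W x * (U * dg d f * mat_adjoint U)) = complex_of_real (\<Sum>i<d. a x i * f i)" for x f
    unfolding mtrace_mult_sandwich_dg[OF Wc U(1)] by (simp add: a del: index_mult_mat(1))
  have a1: "(\<Sum>i<d. a x i) = 1" for x
  proof -
    have "W x * (U * dg d (\<lambda>_. 1) * mat_adjoint U) = W x" using U right_mult_one_mat[OF Wc] by (simp add: dg_one)
    hence "complex_of_real (\<Sum>i<d. a x i) = mtrace (W x)" using tr_W[of x "\<lambda>_. 1"] by simp
    also have "\<dots> = 1" unfolding W mtrace_sandwich_dg[OF V] \<mu>1 by simp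
    finally show ?thesis by (metis of_real_eq_1_iff)
  qed
  have l: "l i = (\<Sum>x\<in>UNIV. p x * a x i)" if i: "i < d" for i
  proof -
    have "complex_of_real (l i) = (mat_adjoint U * ?\<sigma> * U) $$ (i, i)"
    proof -
      have "mat_adjoint U * ?\<sigma> * U = dg d l" unfolding \<sigma>U using U
        by (simp add: assoc_mult_mat[of _ d d _ d _ d] unitary_cancel[OF uU, of _ d])
      thus ?thesis using i by simp
    qed
    also have "\<dots> = (\<Sum>x\<in>UNIV. of_real (p x) * (mat_adjoint U * W x * U) $$ (i, i))"
      unfolding cq_out_def by (rule compression_lincomb[OF U(1) Wc i])
    also have "\<dots> = complex_of_real (\<Sum>x\<in>UNIV. p x * a x i)" using i by (simp add: a del: index_mult_mat(1))
    finally show ?thesis unfolding of_real_eq_iff .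
  qed
  have p0: "0 \<le> p x" and p1: "sum p UNIV = 1" for x using p by (auto simp: distr_def)
  have l0: "0 \<le> l i" if "i < d" for i unfolding l[OF that] using p0 a0 by (intro sum_nonneg) auto
  have "(\<Sum>i<d. l i) = (\<Sum>i<d. \<Sum>x\<in>UNIV. p x * a x i)" by (rule sum.cong) (auto simp: l)
  also have "\<dots> = (\<Sum>x\<in>UNIV. p x * (\<Sum>i<d. a x i))" unfolding sum_distrib_left by (rule sum.swap)
  also have "\<dots> = 1" by (simp add: a1 p1)
  finally have l1: "(\<Sum>i<d. l i) = 1" .
  have lgf: "mlog2 A = mat_fun lg A" for A unfolding mlog2_def lg_def[abs_def] ..
  have re: "rel_entropy (W x) ?\<sigma> = (\<Sum>i<d. \<mu> x i * lg (\<mu> x i)) - (\<Sum>i<d. a x i * lg (l i))" for x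
  proof -
    have m1: "mlog2 (W x) = V x * dg d (\<lambda>i. lg (\<mu> x i)) * mat_adjoint (V x)"
      unfolding lgf W by (rule mat_fun_sandwich_dg[OF V])
    have m2: "mlog2 ?\<sigma> = U * dg d (\<lambda>i. lg (l i)) * mat_adjoint U"
      unfolding lgf \<sigma>U by (rule mat_fun_sandwich_dg[OF uU])
    have c: "mlog2 (W x) \<in> carrier_mat d d" "mlog2 ?\<sigma> \<in> carrier_mat d d"
      unfolding m1 m2 using U unitaryD[OF V] by auto
    have "mtrace (W x * (mlog2 (W x) - mlog2 ?\<sigma>)) = mtrace (W x * mlog2 (W x)) - mtrace (W x * mlog2 ?\<sigma>)"
      using c Wc by (simp add: mult_minus_distrib_mat[of _ d d _ d] mtrace_minus[of _ d])
    also have "W x * mlog2 (W x) = V x * dg d (\<lambda>i. \<mu> x i * lg (\<mu> x i)) * mat_adjoint (V x)"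
      unfolding m1 unfolding W by (rule sandwich_dg_mult[OF V])
    finally show ?thesis unfolding rel_entropy_def m2 tr_W mtrace_sandwich_dg[OF V] by simp
  qed
  have "mutual_info d W p = (\<Sum>x\<in>UNIV. p x * (\<Sum>i<d. \<mu> x i * lg (\<mu> x i))) - (\<Sum>x\<in>UNIV. p x * (\<Sum>i<d. a x i * lg (l i)))"
    by (simp add: mutual_info_def re right_diff_distrib sum_subtractf)
  \<comment> \<open>Averaged over \<open>p\<close>, the distributions \<open>a x\<close> become
    \<open>l\<close>, and the cross entropies collapse to the entropy of the output state.\<close>
  also have "(\<Sum>x\<in>UNIV. p x * (\<Sum>i<d. a x i * lg (l i))) = (\<Sum>i<d. l i * lg (l i))"
  proof -
    have "(\<Sum>x\<in>UNIV. p x * (\<Sum>i<d. a x i * lg (l i))) = (\<Sum>i<d. \<Sum>x\<in>UNIV. p x * (a x i * lg (l i)))"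
      unfolding sum_distrib_left by (rule sum.swap)
    also have "\<dots> = (\<Sum>i<d. l i * lg (l i))"
      by (rule sum.cong) (simp_all add: l sum_distrib_right mult.assoc)
    finally show ?thesis .
  qed
  finally show ?thesis using that[OF uU \<sigma>U a a0 a1 l l0 l1 re] by blast
qed

lemma probability_le_one:
  fixes l :: "nat \<Rightarrow> real"
  assumes "\<And>i. i < d \<Longrightarrow> 0 \<le> l i" "(\<Sum>i<d. l i) = 1" "i < d"
  shows "l i \<le> 1"
proof -
  have "l i \<le> (\<Sum>i<d. l i)" by (rule member_le_sum) (use assms in auto)
  thus ?thesis using assms by simp
qed

text \<open>A supremum of reals carries information only for a bounded set. The mutual information
  is at most the output entropy, and each eigenvalue contributes at most 1 / ln 2 to that.
  Nonnegativity makes every rate above the capacity positive, as \<open>sim_rate\<close>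
  demands.\<close>

lemma capacity_bounds:
  fixes W :: "'x::finite \<Rightarrow> complex mat"
  assumes W: "\<And>x. density d (W x)"
  shows "p \<in> distr UNIV \<Longrightarrow> mutual_info d W p \<le> capacity d W" and "0 \<le> capacity d W"
proof -
  obtain V \<mu> where V: "\<And>x. unitary d (V x)" and WV: "\<And>x. W x = V x * dg d (\<mu> x) * mat_adjoint (V x)"
    and \<mu>0: "\<And>x i. i < d \<Longrightarrow> 0 \<le> \<mu> x i" and \<mu>1: "\<And>x. (\<Sum>i<d. \<mu> x i) = 1"
    using density_spectral[OF W] by metis
  have "mutual_info d W p \<le> real d * (1 / ln 2)" if p: "p \<in> distr UNIV" for p
  proof (rule cq_out_spectral[where W = W and V = V, OF V WV \<mu>0 \<mu>1 p])
    fix l :: "nat \<Rightarrow> real"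
    assume l0: "\<And>i. i < d \<Longrightarrow> 0 \<le> l i" and l1: "(\<Sum>i<d. l i) = 1"
      and mi: "mutual_info d W p = (\<Sum>x\<in>UNIV. p x * (\<Sum>i<d. \<mu> x i * lg (\<mu> x i))) - (\<Sum>i<d. l i * lg (l i))"
    have "\<mu> x i * lg (\<mu> x i) \<le> 0" if "i < d" for x i
      using \<mu>0[OF that] mult_lg_bounds(1)[OF \<mu>0[OF that] probability_le_one[of d "\<mu> x", OF \<mu>0 \<mu>1 that]]
      by (simp add: mult_nonneg_nonpos)
    hence "(\<Sum>i<d. \<mu> x i * lg (\<mu> x i)) \<le> 0" for x by (intro sum_nonpos) simp
    hence "p x * (\<Sum>i<d. \<mu> x i * lg (\<mu> x i)) \<le> 0" for x
      using p by (simp add: distr_def mult_nonneg_nonpos)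
    hence "(\<Sum>x\<in>UNIV. p x * (\<Sum>i<d. \<mu> x i * lg (\<mu> x i))) \<le> 0"
      by (simp add: sum_nonpos)
    moreover have "- (l i * lg (l i)) \<le> 1 / ln 2" if "i < d" for i
      by (rule mult_lg_bounds(2)[OF l0[OF that] probability_le_one[of d l, OF l0 l1 that]])
    hence "(\<Sum>i<d. - (l i * lg (l i))) \<le> (\<Sum>i<d. 1 / ln 2)"
      by (intro sum_mono) auto
    ultimately show ?thesis unfolding mi by (simp add: sum_negf)
  qed
  hence bdd: "bdd_above (mutual_info d W ` distr UNIV)" by (auto simp: bdd_above_def)
  show le: "mutual_info d W p \<le> capacity d W" if "p \<in> distr UNIV" for p
    unfolding capacity_def by (rule cSUP_upper[OF that bdd])
  \<comment> \<open>A point mass: the output is \<open>W x0\<close> itself and the mutual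
    information is 0.\<close>
  define x0 :: 'x where "x0 = undefined"
  define p where "p x = (if x = x0 then 1 else 0 :: real)" for x
  have p: "p \<in> distr UNIV" by (auto simp: distr_def p_def)
  have "cq_out d W p = W x0"
    using W[of x0] by (intro eq_matI) (auto simp: cq_out_def p_def density_def if_distrib[of "\<lambda>z. complex_of_real z * _"] cong: if_cong)
  moreover have "rel_entropy (W x0) (W x0) = 0"
  proof -
    have m: "mlog2 (W x0) \<in> carrier_mat d d"
      unfolding mlog2_def WV mat_fun_sandwich_dg[OF V] using unitaryD[OF V] by simp
    have "W x0 * (mlog2 (W x0) - mlog2 (W x0)) = 0\<^sub>m d d" using m W[of x0] by (auto simp: density_def)
    thus ?thesis by (simp add: rel_entropy_def mtrace_def)
  qed
  ultimately have "mutual_info d W p = 0"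
    by (simp add: mutual_info_def p_def if_distrib[of "\<lambda>z. z * _"] cong: if_cong)
  thus "0 \<le> capacity d W" using le[OF p] by simp
qed

section \<open>Covering a type class\<close>

text \<open>The spectrum of a tensor power of \<sigma> depends on the length alone, so the
  representative \<open>xs0\<close> can stand in for every word of its type.\<close>

lemma digit_prod_const:
  "length xs = length ys \<Longrightarrow> digit_prod d (\<lambda>_. l) xs = digit_prod d (\<lambda>_. l) ys"
  by (induction xs ys rule: list_induct2) (auto intro!: ext)

text \<open>\<open>B\<close> is \<open>\<Pi>\<^sub>\<sigma> \<sigma>\<^sup>1\<^sup>/\<^sup>2\<close> for \<open>\<sigma> = W(P)\<^sup>\<otimes>\<^sup>n\<close>, up to a unitary factor; it depends on the type only,
  whereas \<open>v\<close> depends on the word.\<close>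

lemma type_cover:
  fixes W :: "'x::finite \<Rightarrow> complex mat"
  assumes V: "\<And>x. unitary d (V x)" and W: "\<And>x. W x = V x * dg d (\<mu> x) * mat_adjoint (V x)"
    and \<mu>0: "\<And>x i. i < d \<Longrightarrow> 0 \<le> \<mu> x i" and \<mu>1: "\<And>x. (\<Sum>i<d. \<mu> x i) = 1"
    and C: "\<And>p. p \<in> distr UNIV \<Longrightarrow> mutual_info d W p \<le> C"
    and n: "0 < n" and \<delta>: "0 < \<delta>" and xs0: "xs0 \<in> words n"
    and \<epsilon>: "\<epsilon> = real d * (4 / (ln 2)\<^sup>2) / (real n * \<delta>\<^sup>2)"
  shows "\<exists>B\<in>carrier_mat (d ^ n) (d ^ n).
    (\<forall>S X. unitary (d ^ n) S \<longrightarrow> X \<in> carrier_mat (d ^ n) (d ^ n) \<longrightarrow> cmod (mtrace (S * B * X)) \<le> sqrt (fro X)) \<and>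
    (\<forall>xs\<in>words n. count_list xs = count_list xs0 \<longrightarrow>
      (\<exists>v\<in>carrier_mat (d ^ n) (d ^ n). fro v \<le> 2 powr (real n * (C + 2 * \<delta>)) \<and>
        (\<forall>S. unitary (d ^ n) S \<longrightarrow>
          cmod (mtrace (S * tensor_list (map W xs)) - mtrace (S * B * v)) \<le> \<epsilon> + sqrt \<epsilon>)))"
proof -
  define P where "P x = real (count_list xs0 x) / real n" for x
  have len0: "length xs0 = n" using xs0 by (simp add: words_def)
  \<comment> \<open>Letterwise sums along a word are determined by its type, so all words of the
    type share the same value of \<open>Hr\<close>.\<close>
  have sum_type: "(\<Sum>x\<leftarrow>xs. f x) = real n * (\<Sum>x\<in>UNIV. P x * f x)"
    if "count_list xs = count_list xs0" for xs and f :: "'x \<Rightarrow> real"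
    unfolding sum_list_map_eq_sum_count_list[of UNIV, OF finite_UNIV subset_UNIV] that P_def sum_distrib_left
    using n by (intro sum.cong) auto
  have "real n * sum P UNIV = real n" using sum_type[of xs0 "\<lambda>_. 1"] len0 by (simp add: sum_list_triv)
  hence P: "P \<in> distr UNIV" using n by (auto simp: distr_def P_def)
  show ?thesis
  proof (rule cq_out_spectral[where W = W and V = V, OF V W \<mu>0 \<mu>1 P])
    fix U l a
    assume uU: "unitary d U"
      and a: "\<And>x i. i < d \<Longrightarrow> (mat_adjoint U * W x * U) $$ (i, i) = complex_of_real (a x i)"
      and a0: "\<And>x i. i < d \<Longrightarrow> 0 \<le> a x i" and a1: "\<And>x. (\<Sum>i<d. a x i) = 1"
      and l: "\<And>i. i < d \<Longrightarrow> l i = (\<Sum>x\<in>UNIV. P x * a x i)"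
      and l0: "\<And>i. i < d \<Longrightarrow> 0 \<le> l i" and l1: "(\<Sum>i<d. l i) = 1"
      and mi: "mutual_info d W P = (\<Sum>x\<in>UNIV. P x * (\<Sum>i<d. \<mu> x i * lg (\<mu> x i))) - (\<Sum>i<d. l i * lg (l i))"
    let ?N = "d ^ n"
    \<comment> \<open>Each of the two logarithms may deviate by n \<delta>; as both a numerator and
      a denominator are affected, each deviation on both sides of the quotient adds up to 2 n
      \<delta> in the exponent.\<close>
    define t where "t = real n * \<delta>"
    have t: "0 < t" using n \<delta> by (simp add: t_def)
    define Hs where "Hs = real n * (\<Sum>i<d. l i * lg (l i))"
    define Ut where "Ut = tensor_list (replicate n U)"
    define ls where "ls = digit_prod d (\<lambda>_. l) xs0"
    define g where "g i = typ_ind Hs t (ls i)" for i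
    define B where "B = Ut * dg ?N (\<lambda>i. g i * sqrt (ls i))"
    have rep: "map (\<lambda>_. U) xs = replicate n U" if "length xs = n" for xs :: "'x list"
      using that by (simp add: map_replicate_const)
    have uUt: "unitary ?N Ut"
      using tensor_list_unitary[of d "\<lambda>_. U" xs0, OF uU] unfolding Ut_def rep[OF len0] len0 .
    note Ut = unitaryD[OF uUt]
    have ls0: "0 \<le> ls i" if "i < ?N" for i unfolding ls_def by (rule digit_prod_nonneg) (use l0 that len0 in auto)
    have ls1: "(\<Sum>i<?N. ls i) = 1" unfolding ls_def using digit_prod_sum[of "\<lambda>_. l" d xs0, OF l1] len0 by simp
    have g01: "g i \<in> {0, 1}" for i by (simp add: g_def typ_ind_def)
    have g_ls: "2 powr (Hs - t) \<le> ls i" if "g i = 1" for i using that by (auto simp: g_def typ_ind_def split: if_splits)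
    have B: "B \<in> carrier_mat ?N ?N" using Ut by (simp add: B_def)
    \<comment> \<open>The outcome distributions of single letters differ from the spectrum of
      \<sigma> but average to it over the type; hence \<open>Hs\<close> is the right centre for
      every word of the type.\<close>
    have mean: "real n * (\<Sum>x\<in>UNIV. P x * (\<Sum>i<d. a x i * f i)) = real n * (\<Sum>i<d. l i * f i)" for f
    proof -
      have "(\<Sum>x\<in>UNIV. P x * (\<Sum>i<d. a x i * f i)) = (\<Sum>i<d. \<Sum>x\<in>UNIV. P x * (a x i * f i))"
        unfolding sum_distrib_left by (rule sum.swap)
      also have "\<dots> = (\<Sum>i<d. l i * f i)"
        by (rule sum.cong) (simp_all add: l sum_distrib_right mult.assoc)
      finally show ?thesis by simp
    qed
    \<comment> \<open>The origin of \<epsilon>: the variance bound for \<open>n\<close> letters over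
      the squared deviation.\<close>
    have var: "real n * (real d * (4 / (ln 2)\<^sup>2)) / t\<^sup>2 = \<epsilon>"
      unfolding \<epsilon> t_def using n by (simp add: power2_eq_square)
    have second: "(\<Sum>i<d. f i * (lg (f i))\<^sup>2) \<le> real d * (4 / (ln 2)\<^sup>2)"
      if "\<And>i. i < d \<Longrightarrow> 0 \<le> f i" "(\<Sum>i<d. f i) = 1" for f
    proof -
      have "(\<Sum>i<d. f i * (lg (f i))\<^sup>2) \<le> (\<Sum>i<d. 4 / (ln 2)\<^sup>2)"
        by (intro sum_mono mult_lg_bounds(3) that(1) probability_le_one[of d f, OF that]) auto
      thus ?thesis by simp
    qed
    have "\<exists>v\<in>carrier_mat ?N ?N. fro v \<le> 2 powr (real n * (C + 2 * \<delta>)) \<and>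
        (\<forall>S. unitary ?N S \<longrightarrow>
          cmod (mtrace (S * tensor_list (map W xs)) - mtrace (S * B * v)) \<le> \<epsilon> + sqrt \<epsilon>)"
      if xs: "xs \<in> words n" and same: "count_list xs = count_list xs0" for xs
    proof -
      have len: "length xs = n" using xs by (simp add: words_def)
      define Vt where "Vt = tensor_list (map V xs)"
      define m where "m = digit_prod d \<mu> xs"
      define Hr where "Hr = (\<Sum>x\<leftarrow>xs. \<Sum>i<d. \<mu> x i * lg (\<mu> x i))"
      define g' where "g' i = typ_ind Hr t (m i)" for i
      define v where "v = reduced ?N Ut ls Vt m g g'"
      have uVt: "unitary ?N Vt" using tensor_list_unitary[of d V xs, OF V] by (simp add: Vt_def len)
      note Vt = unitaryD[OF uVt]
      have m0: "0 \<le> m i" if "i < ?N" for i unfolding m_def by (rule digit_prod_nonneg) (use \<mu>0 that len in auto)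
      have m1: "(\<Sum>i<?N. m i) = 1" unfolding m_def using digit_prod_sum[of \<mu> d xs, OF \<mu>1] len by simp
      have g'01: "g' i \<in> {0, 1}" for i by (simp add: g'_def typ_ind_def)
      have g'm: "m i \<le> 2 powr (Hr + t)" if "g' i = 1" for i using that by (auto simp: g'_def typ_ind_def split: if_splits)
      have v: "v \<in> carrier_mat ?N ?N" unfolding v_def using Ut Vt by simp
      have ls: "digit_prod d (\<lambda>_. l) xs = ls" unfolding ls_def by (rule digit_prod_const) (simp add: len len0)
      have Vc: "V x \<in> carrier_mat d d" "mat_adjoint (V x) \<in> carrier_mat d d" for x using unitaryD[OF V] by auto
      have Uc: "U \<in> carrier_mat d d" "mat_adjoint U \<in> carrier_mat d d" using unitaryD[OF uU] by auto
      have Wc: "W x \<in> carrier_mat d d" for x using Vc by (simp add: W)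
      have WV: "tensor_list (map W xs) = Vt * dg ?N m * mat_adjoint Vt"
      proof -
        have "Vt * dg ?N m = tensor_list (map (\<lambda>x. V x * dg d (\<mu> x)) xs)"
          unfolding Vt_def m_def len[symmetric] tensor_list_dg[symmetric] by (rule tensor_list_mult[of _ d]) (simp_all add: Vc)
        moreover have "mat_adjoint Vt = tensor_list (map (\<lambda>x. mat_adjoint (V x)) xs)"
          unfolding Vt_def by (rule tensor_list_adj[OF Vc(1)])
        moreover have "tensor_list (map (\<lambda>x. V x * dg d (\<mu> x)) xs) * tensor_list (map (\<lambda>x. mat_adjoint (V x)) xs)
            = tensor_list (map (\<lambda>x. V x * dg d (\<mu> x) * mat_adjoint (V x)) xs)"
          by (rule tensor_list_mult[of _ d]) (simp_all add: Vc)
        ultimately show ?thesis by (simp flip: W)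
      qed
      have comp: "mat_adjoint Ut * tensor_list (map W xs) * Ut = tensor_list (map (\<lambda>x. mat_adjoint U * W x * U) xs)"
      proof -
        have "mat_adjoint Ut = tensor_list (map (\<lambda>x. mat_adjoint U) xs)"
          unfolding Ut_def rep[OF len, symmetric] by (rule tensor_list_adj[OF Uc(1)])
        moreover have "tensor_list (map (\<lambda>x. mat_adjoint U) xs) * tensor_list (map W xs)
            = tensor_list (map (\<lambda>x. mat_adjoint U * W x) xs)"
          by (rule tensor_list_mult[of _ d]) (simp_all add: Uc Wc)
        moreover have "tensor_list (map (\<lambda>x. mat_adjoint U * W x) xs) * Ut = tensor_list (map (\<lambda>x. mat_adjoint U * W x * U) xs)"
          unfolding Ut_def rep[OF len, symmetric] by (rule tensor_list_mult[of _ d]) (simp_all add: Uc Wc)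
        ultimately show ?thesis by simp
      qed
      have an: "(mat_adjoint Ut * (Vt * dg ?N m * mat_adjoint Vt) * Ut) $$ (i, i) = complex_of_real (digit_prod d a xs i)"
        if "i < ?N" for i
        unfolding WV[symmetric] comp by (rule tensor_list_diag[of _ d]) (use a Uc Wc that len in auto)
      \<comment> \<open>The upper bound for kept eigenvalues of \<rho> over the lower bound for
        those of \<sigma>; the difference of the two centres is n I(P).\<close>
      have "fro v \<le> 2 powr (Hr + t) / 2 powr (Hs - t)" unfolding v_def
        by (rule fro_reduced_le[OF uUt uVt m0 m1 g01 g'01]) (use g_ls g'm in auto)
      also have "\<dots> = 2 powr (Hr - Hs + 2 * t)" by (simp flip: powr_diff) (simp add: algebra_simps)
      also have "\<dots> \<le> 2 powr (real n * (C + 2 * \<delta>))"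
      proof -
        have "Hr - Hs = real n * mutual_info d W P"
          unfolding mi Hr_def Hs_def sum_type[OF same] by (simp add: algebra_simps)
        also have "\<dots> \<le> real n * C" using C[OF P] by (intro mult_left_mono) auto
        finally show ?thesis by (simp add: t_def algebra_simps)
      qed
      finally have frov: "fro v \<le> 2 powr (real n * (C + 2 * \<delta>))" .
      have e1: "(\<Sum>i<?N. m i * (1 - g' i)) \<le> \<epsilon>"
      proof -
        have "(\<Sum>i<?N. m i * (1 - g' i)) \<le> (\<Sum>x\<leftarrow>xs. \<Sum>i<d. \<mu> x i * (lg (\<mu> x i))\<^sup>2) / t\<^sup>2"
          unfolding m_def g'_def len[symmetric] by (rule digit_prod_chebyshev[OF \<mu>0 \<mu>1 \<mu>0 _ t Hr_def])
        also have "\<dots> \<le> (\<Sum>x\<leftarrow>xs. real d * (4 / (ln 2)\<^sup>2)) / t\<^sup>2"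
          by (intro divide_right_mono sum_list_mono second \<mu>0 \<mu>1) auto
        also have "\<dots> = \<epsilon>" using var len by (simp add: sum_list_triv)
        finally show ?thesis .
      qed
      have e2: "(\<Sum>i<?N. digit_prod d a xs i * (1 - g i)) \<le> \<epsilon>"
      proof -
        \<comment> \<open>The support hypothesis for Chebyshev: a letter of the word has positive
          weight in \<open>P\<close>, so where the average \<open>l\<close> vanishes its own outcome
          probability vanishes too.\<close>
        have "a x i = 0" if x: "x \<in> set xs" and i: "i < d" and z: "l i = 0" for x i
        proof -
          have "0 \<le> P y * a y i" for y using a0[OF i] by (simp add: P_def)
          hence "P x * a x i = 0" using l[OF i] z sum_nonneg_eq_0_iff[of UNIV "\<lambda>y. P y * a y i"] by simp
          moreover have "count_list xs0 x \<noteq> 0" using x unfolding same[symmetric] by (simp add: count_list_0_iff)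
          ultimately show ?thesis using n by (simp add: P_def)
        qed
        moreover have "Hs = (\<Sum>x\<leftarrow>xs. \<Sum>i<d. a x i * lg (l i))"
          unfolding sum_type[OF same] mean Hs_def ..
        ultimately have "(\<Sum>i<?N. digit_prod d a xs i * (1 - g i)) \<le> (\<Sum>x\<leftarrow>xs. \<Sum>i<d. a x i * (lg (l i))\<^sup>2) / t\<^sup>2"
          unfolding g_def len[symmetric] ls[symmetric] by (intro digit_prod_chebyshev a0 a1 l0 t) auto
        also have "\<dots> = real n * (\<Sum>i<d. l i * (lg (l i))\<^sup>2) / t\<^sup>2"
          unfolding sum_type[OF same] mean ..
        also have "\<dots> \<le> real n * (real d * (4 / (ln 2)\<^sup>2)) / t\<^sup>2"
          by (intro divide_right_mono mult_left_mono second l0 l1) auto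
        also have "\<dots> = \<epsilon>" by (rule var)
        finally show ?thesis .
      qed
      have "cmod (mtrace (S * tensor_list (map W xs)) - mtrace (S * B * v)) \<le> \<epsilon> + sqrt \<epsilon>" if uS: "unitary ?N S" for S
      proof -
        note S = unitaryD[OF uS]
        have pos: "0 < ls i" if "g i = 1" for i
          by (rule less_le_trans[OF _ g_ls[OF that]]) simp
        have "truncated ?N Ut Vt m g g' = B * v" unfolding B_def v_def
          by (rule truncate_eq_reduced[OF Ut(1) Vt(1) g01]) (rule pos)
        hence "S * B * v = S * truncated ?N Ut Vt m g g'"
          using S B v by (simp add: assoc_mult_mat[of _ ?N ?N _ ?N _ ?N])
        hence "cmod (mtrace (S * tensor_list (map W xs)) - mtrace (S * B * v))
           \<le> (\<Sum>i<?N. m i * (1 - g' i)) + sqrt (\<Sum>i<?N. digit_prod d a xs i * (1 - g i))"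
          unfolding WV using truncate_error[OF uS uUt uVt m0 m1 g01 g'01 an] by simp
        also have "\<dots> \<le> \<epsilon> + sqrt \<epsilon>" using e1 e2 by (intro add_mono) auto
        finally show ?thesis .
      qed
      with v frov show ?thesis by blast
    qed
    moreover have "cmod (mtrace (S * B * X)) \<le> sqrt (fro X)"
      if "unitary ?N S" "X \<in> carrier_mat ?N ?N" for S X
      unfolding B_def by (rule mtrace_unitary_mult_le_fro[OF that(1) uUt that(2) ls0 ls1 g01])
    ultimately show ?thesis using B by blast
  qed
qed

section \<open>The approximation error\<close>

text \<open>The test matrix \<open>S\<close> depends on both distributions; this is harmless because
  the bounds for single words hold for every unitary matrix.\<close>

lemma trace_norm_cq_out_n_diff:
  fixes W :: "'x::finite \<Rightarrow> complex mat"
  assumes "\<And>x. W x \<in> carrier_mat d d" "\<And>x. mat_adjoint (W x) = W x"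
  shows "0 \<le> trace_norm (cq_out_n d W n p - cq_out_n d W n q)"
    and "\<exists>S. unitary (d ^ n) S \<and> trace_norm (cq_out_n d W n p - cq_out_n d W n q)
      = Re (\<Sum>xs\<in>words n. of_real (p xs - q xs) * mtrace (S * tensor_list (map W xs)))"
proof -
  let ?N = "d ^ n" and ?A = "cq_out_n d W n p - cq_out_n d W n q"
  let ?B = "mat ?N ?N (\<lambda>(i, j). \<Sum>xs\<in>words n. complex_of_real (p xs - q xs) * tensor_list (map W xs) $$ (i, j))"
  have AB: "?A = ?B" by (rule eq_matI) (auto simp: cq_out_n_def sum_subtractf[symmetric] algebra_simps)
  have "?B = cq_out_n d W n (\<lambda>xs. p xs - q xs)" by (simp add: cq_out_n_def)
  hence h: "mat_adjoint ?A = ?A" unfolding AB by (simp only: cq_out_n_hermitian[of W d, OF assms])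
  have A: "?A \<in> carrier_mat ?N ?N" by (simp add: AB)
  from trace_norm_variational[OF A h] obtain S where S: "unitary ?N S" "trace_norm ?A = Re (mtrace (S * ?A))" "0 \<le> trace_norm ?A" .
  have W: "tensor_list (map W xs) \<in> carrier_mat ?N ?N" if "xs \<in> words n" for xs
    using tensor_list_carrier[of W d xs, OF assms(1)] that by (simp add: words_def)
  have "mtrace (S * ?A) = (\<Sum>xs\<in>words n. of_real (p xs - q xs) * mtrace (S * tensor_list (map W xs)))"
    unfolding AB by (rule mtrace_mult_lincomb[OF unitaryD(1)[OF S(1)] W])
  with S(1,2) show "\<exists>S. unitary ?N S \<and> trace_norm ?A
      = Re (\<Sum>xs\<in>words n. of_real (p xs - q xs) * mtrace (S * tensor_list (map W xs)))" by auto
  show "0 \<le> trace_norm ?A" by (rule S(3))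
qed

text \<open>The approximating \<open>q\<close> must serve all types at once. Vectors of different
  types are placed in orthogonal summands, so one run of the empirical method controls every type,
  and the \<open>M\<close> points need not be divided among the types in advance.\<close>

lemma approximation_by_M_type:
  fixes W :: "'x::finite \<Rightarrow> complex mat"
  assumes W: "\<And>x. density d (W x)" and n: "0 < n" and M: "0 < M" and \<delta>: "0 < \<delta>"
    and \<epsilon>: "\<epsilon> = real d * (4 / (ln 2)\<^sup>2) / (real n * \<delta>\<^sup>2)" and p: "p \<in> distr (words n)"
  obtains q where "q \<in> distr_M M n"
    "trace_norm (cq_out_n d W n p - cq_out_n d W n q)
      \<le> 2 * (\<epsilon> + sqrt \<epsilon>) + real ((n + 1) ^ card (UNIV :: 'x set)) * sqrt (2 powr (real n * (capacity d W + 2 * \<delta>)) / real M)"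
proof -
  let ?N = "d ^ n" and ?C = "capacity d W" and ?T = "count_list ` (words n :: 'x list set)"
  let ?b = "2 powr (real n * (?C + 2 * \<delta>))"
  obtain V \<mu> where V: "\<And>x. unitary d (V x)" and WV: "\<And>x. W x = V x * dg d (\<mu> x) * mat_adjoint (V x)"
    and \<mu>0: "\<And>x i. i < d \<Longrightarrow> 0 \<le> \<mu> x i" and \<mu>1: "\<And>x. (\<Sum>i<d. \<mu> x i) = 1"
    using density_spectral[OF W] by metis
  have Wc: "W x \<in> carrier_mat d d" and Wh: "mat_adjoint (W x) = W x" for x
    using W[of x] by (auto simp: density_def psd_def hermitian_def)
  define Q where "Q c B \<longleftrightarrow> B \<in> carrier_mat ?N ?N \<and>
    (\<forall>S X. unitary ?N S \<longrightarrow> X \<in> carrier_mat ?N ?N \<longrightarrow> cmod (mtrace (S * B * X)) \<le> sqrt (fro X)) \<and>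
    (\<forall>xs\<in>words n. count_list xs = c \<longrightarrow>
      (\<exists>v\<in>carrier_mat ?N ?N. fro v \<le> ?b \<and> (\<forall>S. unitary ?N S \<longrightarrow>
          cmod (mtrace (S * tensor_list (map W xs)) - mtrace (S * B * v)) \<le> \<epsilon> + sqrt \<epsilon>)))" for c :: "'x \<Rightarrow> nat" and B
  have "\<exists>B. Q c B" if c: "c \<in> ?T" for c
  proof -
    from c obtain xs0 :: "'x list" where "xs0 \<in> words n" "c = count_list xs0" by blast
    thus ?thesis
      using type_cover[where W = W and V = V, OF V WV \<mu>0 \<mu>1 capacity_bounds(1)[where W = W, OF W] n \<delta> _ \<epsilon>] unfolding Q_def by blast
  qed
  then obtain B where B: "\<And>c. c \<in> ?T \<Longrightarrow> Q c (B c)" by metis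
  have "\<forall>xs\<in>words n. \<exists>v. v \<in> carrier_mat ?N ?N \<and> fro v \<le> ?b \<and> (\<forall>S. unitary ?N S \<longrightarrow>
          cmod (mtrace (S * tensor_list (map W xs)) - mtrace (S * B (count_list xs) * v)) \<le> \<epsilon> + sqrt \<epsilon>)"
    using B unfolding Q_def by blast
  then obtain v where v: "\<And>xs. xs \<in> words n \<Longrightarrow> v xs \<in> carrier_mat ?N ?N"
    and fro_v: "\<And>xs. xs \<in> words n \<Longrightarrow> fro (v xs) \<le> ?b"
    and err: "\<And>xs S. xs \<in> words n \<Longrightarrow> unitary ?N S \<Longrightarrow>
          cmod (mtrace (S * tensor_list (map W xs)) - mtrace (S * B (count_list xs) * v xs)) \<le> \<epsilon> + sqrt \<epsilon>"
    by metis
  \<comment> \<open>One copy of the Hilbert-Schmidt space per type; \<open>u xs\<close> is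
    \<open>v xs\<close> in the summand of its type and zero elsewhere, so its norm is
    unchanged.\<close>
  define I where "I = ?T \<times> ({..<?N} \<times> {..<?N})"
  define u where "u xs k = (if fst k = count_list xs then v xs $$ snd k else 0)" for xs and k :: "('x \<Rightarrow> nat) \<times> nat \<times> nat"
  have finI: "finite I" by (simp add: I_def)
  have u_sum: "(\<Sum>k\<in>I. (cmod (f k))\<^sup>2) = (\<Sum>c\<in>?T. fro (mat ?N ?N (\<lambda>ij. f (c, ij))))"
    for f :: "('x \<Rightarrow> nat) \<times> nat \<times> nat \<Rightarrow> complex"
    unfolding I_def by (simp add: fro_def sum.cartesian_product split_def)
  have ub: "(\<Sum>k\<in>I. (cmod (u xs k))\<^sup>2) \<le> ?b" if xs: "xs \<in> words n" for xs
  proof -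
    have "(\<Sum>k\<in>I. (cmod (u xs k))\<^sup>2) = (\<Sum>c\<in>?T. if c = count_list xs then fro (v xs) else 0)"
      unfolding u_sum
    proof (rule sum.cong)
      fix c
      show "fro (mat ?N ?N (\<lambda>ij. u xs (c, ij))) = (if c = count_list xs then fro (v xs) else 0)"
        using v[OF xs] by (auto simp: u_def fro_def)
    qed simp
    also have "\<dots> = fro (v xs)" using xs by simp
    finally show ?thesis using fro_v[OF xs] by simp
  qed
  obtain q where q: "q \<in> distr_M M n"
    and dev: "(\<Sum>k\<in>I. (cmod (\<Sum>xs\<in>words n. of_real (p xs - q xs) * u xs k))\<^sup>2) \<le> ?b / real M"
    using maurey_distr_M[of I p n M u ?b, OF finI p M ub] by blast
  \<comment> \<open>The component of the deviation in the summand of type \<open>c\<close>.\<close>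
  define X where "X c = mat ?N ?N (\<lambda>(i, j). \<Sum>xs\<in>{xs \<in> words n. count_list xs = c}. complex_of_real (p xs - q xs) * v xs $$ (i, j))" for c
  have Xc: "X c \<in> carrier_mat ?N ?N" for c by (simp add: X_def)
  have "X c = mat ?N ?N (\<lambda>ij. \<Sum>xs\<in>words n. of_real (p xs - q xs) * u xs (c, ij))" for c
  proof -
    have "(\<Sum>xs\<in>{xs \<in> words n. count_list xs = c}. complex_of_real (p xs - q xs) * v xs $$ ij)
        = (\<Sum>xs\<in>words n. of_real (p xs - q xs) * u xs (c, ij))" for ij
      by (rule sum.mono_neutral_cong_left) (auto simp: u_def)
    thus ?thesis unfolding X_def by (simp add: split_def)
  qed
  with dev have froX: "(\<Sum>c\<in>?T. fro (X c)) \<le> ?b / real M" unfolding u_sum by simp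
  obtain S where S: "unitary ?N S" and tn: "trace_norm (cq_out_n d W n p - cq_out_n d W n q)
      = Re (\<Sum>xs\<in>words n. of_real (p xs - q xs) * mtrace (S * tensor_list (map W xs)))"
    using trace_norm_cq_out_n_diff(2)[of W d n p q, OF Wc Wh] by blast
  have pq: "0 \<le> p xs" "0 \<le> q xs" "sum p (words n) = 1" "sum q (words n) = 1" for xs
    using p q by (auto simp: distr_def distr_M_def)
  let ?y = "\<lambda>xs. mtrace (S * tensor_list (map W xs))" and ?z = "\<lambda>xs. mtrace (S * B (count_list xs) * v xs)"
  have "trace_norm (cq_out_n d W n p - cq_out_n d W n q) \<le> cmod (\<Sum>xs\<in>words n. of_real (p xs - q xs) * ?y xs)"
    unfolding tn by (rule complex_Re_le_cmod)
  also have "(\<Sum>xs\<in>words n. of_real (p xs - q xs) * ?y xs)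
      = (\<Sum>xs\<in>words n. of_real (p xs - q xs) * (?y xs - ?z xs)) + (\<Sum>xs\<in>words n. of_real (p xs - q xs) * ?z xs)"
    by (simp add: sum.distrib[symmetric] right_diff_distrib)
  also have "cmod \<dots> \<le> cmod (\<Sum>xs\<in>words n. of_real (p xs - q xs) * (?y xs - ?z xs)) + cmod (\<Sum>xs\<in>words n. of_real (p xs - q xs) * ?z xs)"
    by (rule norm_triangle_ineq)
  also have "\<dots> \<le> 2 * (\<epsilon> + sqrt \<epsilon>) + real ((n + 1) ^ card (UNIV :: 'x set)) * sqrt (?b / real M)"
  proof (rule add_mono)
    \<comment> \<open>The masses of \<open>p\<close> and \<open>q\<close> add up to 2, so the
      truncation error is paid twice and not once per word.\<close>
    have "cmod (\<Sum>xs\<in>words n. of_real (p xs - q xs) * (?y xs - ?z xs)) \<le> (\<Sum>xs\<in>words n. (p xs + q xs) * (\<epsilon> + sqrt \<epsilon>))"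
    proof (rule sum_norm_le)
      fix xs :: "'x list" assume xs: "xs \<in> words n"
      have "\<bar>p xs - q xs\<bar> \<le> p xs + q xs" using pq(1)[of xs] pq(2)[of xs] by auto
      moreover have "0 \<le> p xs + q xs" using pq(1)[of xs] pq(2)[of xs] by auto
      ultimately show "cmod (of_real (p xs - q xs) * (?y xs - ?z xs)) \<le> (p xs + q xs) * (\<epsilon> + sqrt \<epsilon>)"
        unfolding norm_mult norm_of_real using err[OF xs S] by (intro mult_mono) auto
    qed
    also have "\<dots> = 2 * (\<epsilon> + sqrt \<epsilon>)" unfolding sum_distrib_right[symmetric] sum.distrib pq by simp
    finally show "cmod (\<Sum>xs\<in>words n. of_real (p xs - q xs) * (?y xs - ?z xs)) \<le> 2 * (\<epsilon> + sqrt \<epsilon>)" .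
    have "(\<Sum>xs\<in>words n. of_real (p xs - q xs) * ?z xs)
        = (\<Sum>c\<in>?T. \<Sum>xs\<in>{xs \<in> words n. count_list xs = c}. of_real (p xs - q xs) * ?z xs)"
      by (rule sum.image_gen) simp
    also have "\<dots> = (\<Sum>c\<in>?T. mtrace (S * B c * X c))"
    proof (rule sum.cong)
      fix c assume "c \<in> ?T"
      hence "B c \<in> carrier_mat ?N ?N" using B[of c] by (simp add: Q_def)
      hence "mtrace (S * B c * X c) = (\<Sum>xs\<in>{xs \<in> words n. count_list xs = c}. of_real (p xs - q xs) * mtrace (S * B c * v xs))"
        unfolding X_def using unitaryD[OF S] v by (intro mtrace_mult_lincomb) auto
      thus "(\<Sum>xs\<in>{xs \<in> words n. count_list xs = c}. of_real (p xs - q xs) * ?z xs) = mtrace (S * B c * X c)"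
        by simp
    qed simp
    \<comment> \<open>Each component is at most as long as the whole deviation, and there is one
      component per type.\<close>
    also have "cmod \<dots> \<le> (\<Sum>c\<in>?T. sqrt (?b / real M))"
    proof (rule sum_norm_le)
      fix c assume c: "c \<in> ?T"
      have "cmod (mtrace (S * B c * X c)) \<le> sqrt (fro (X c))" using B[OF c] S Xc by (simp add: Q_def)
      also have "fro (X c) \<le> (\<Sum>c\<in>?T. fro (X c))" by (rule member_le_sum) (use c in \<open>auto simp: fro_nonneg\<close>)
      finally show "cmod (mtrace (S * B c * X c)) \<le> sqrt (?b / real M)" using froX by (meson order_trans real_sqrt_le_mono)
    qed
    also have "\<dots> \<le> real ((n + 1) ^ card (UNIV :: 'x set)) * sqrt (?b / real M)"
      unfolding sum_constant using card_types_le(2)[of n, where ?'x = 'x] by (intro mult_right_mono of_nat_mono) auto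
    finally show "cmod (\<Sum>xs\<in>words n. of_real (p xs - q xs) * ?z xs) \<le> real ((n + 1) ^ card (UNIV :: 'x set)) * sqrt (?b / real M)" .
  qed
  finally show ?thesis using q that by blast
qed

text \<open>Real suprema and infima need nonempty bounded sets: the trace norms are at least 0, and
  the estimate, uniform in \<open>p\<close>, bounds the infima from above.\<close>

lemma approx_err_bounds:
  fixes W :: "'x::finite \<Rightarrow> complex mat"
  assumes W: "\<And>x. density d (W x)" and n: "0 < n" and M: "0 < M" and \<delta>: "0 < \<delta>"
  shows "0 \<le> approx_err d W n M"
    "approx_err d W n M \<le> (let \<epsilon> = real d * (4 / (ln 2)\<^sup>2) / (real n * \<delta>\<^sup>2) in 2 * (\<epsilon> + sqrt \<epsilon>)
        + real ((n + 1) ^ card (UNIV :: 'x set)) * sqrt (2 powr (real n * (capacity d W + 2 * \<delta>)) / real M)) / 2"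
proof -
  define \<epsilon> where "\<epsilon> = real d * (4 / (ln 2)\<^sup>2) / (real n * \<delta>\<^sup>2)"
  define K where "K = 2 * (\<epsilon> + sqrt \<epsilon>)
        + real ((n + 1) ^ card (UNIV :: 'x set)) * sqrt (2 powr (real n * (capacity d W + 2 * \<delta>)) / real M)"
  define f where "f p q = trace_norm (cq_out_n d W n p - cq_out_n d W n q) / 2" for p q
  have Wc: "W x \<in> carrier_mat d d" and Wh: "mat_adjoint (W x) = W x" for x
    using W[of x] by (auto simp: density_def psd_def hermitian_def)
  have f0: "0 \<le> f p q" for p q
    using trace_norm_cq_out_n_diff(1)[of W d n p q, OF Wc Wh] by (simp add: f_def)
  have ex: "\<exists>q\<in>distr_M M n. f p q \<le> K / 2" if "p \<in> distr (words n)" for p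
    using approximation_by_M_type[of d W n M \<delta> \<epsilon> p, OF W n M \<delta> \<epsilon>_def that] unfolding f_def K_def
    by (metis divide_right_mono zero_le_numeral)
  have inf0: "0 \<le> (INF q\<in>distr_M M n. f p q)" if "p \<in> distr (words n)" for p
    by (rule cINF_greatest) (use ex[OF that] f0 in auto)
  have infK: "(INF q\<in>distr_M M n. f p q) \<le> K / 2" if p: "p \<in> distr (words n)" for p
  proof -
    obtain q where q: "q \<in> distr_M M n" "f p q \<le> K / 2" using ex[OF p] by blast
    show ?thesis by (rule cINF_lower2[where f = "f p", OF _ q]) (use f0 in \<open>auto simp: bdd_below_def\<close>)
  qed
  define w :: "'x list" where "w = replicate n undefined"
  have w: "w \<in> words n" by (simp add: w_def words_def)
  have p0: "(\<lambda>x. if x = w then 1 else 0 :: real) \<in> distr (words n)" using w by (auto simp: distr_def)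
  have err: "approx_err d W n M = (SUP p\<in>distr (words n). INF q\<in>distr_M M n. f p q)"
    by (simp add: approx_err_def f_def)
  have "bdd_above ((\<lambda>p. INF q\<in>distr_M M n. f p q) ` distr (words n))" using infK by (intro bdd_aboveI2[of _ _ "K / 2"])
  from cSUP_upper[OF p0 this] show "0 \<le> approx_err d W n M" unfolding err using inf0[OF p0] by linarith
  have "approx_err d W n M \<le> K / 2" unfolding err by (rule cSUP_least) (use p0 infK in auto)
  thus "approx_err d W n M \<le> (let \<epsilon> = real d * (4 / (ln 2)\<^sup>2) / (real n * \<delta>\<^sup>2) in 2 * (\<epsilon> + sqrt \<epsilon>)
        + real ((n + 1) ^ card (UNIV :: 'x set)) * sqrt (2 powr (real n * (capacity d W + 2 * \<delta>)) / real M)) / 2"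
    by (simp add: Let_def K_def \<epsilon>_def)
qed

text \<open>Of the gap 4 \<delta> between \<open>D\<close> and the capacity, 2 \<delta> is spent in
  the Hilbert-Schmidt bound. After the square root the rest leaves a decay of 2 to the power -
  \<delta> n, which beats the polynomial number of types.\<close>

lemma approx_err_tendsto_0:
  fixes W :: "'x::finite \<Rightarrow> complex mat"
  assumes W: "\<And>x. density d (W x)" and D: "capacity d W < D"
  shows "(\<lambda>n. approx_err d W n (nat \<lfloor>2 powr (real n * D)\<rfloor>)) \<longlonglongrightarrow> 0"
proof -
  define \<delta> where "\<delta> = (D - capacity d W) / 4"
  have \<delta>: "0 < \<delta>" and D4: "D = capacity d W + 4 * \<delta>" using D by (auto simp: \<delta>_def field_simps)
  have Dpos: "0 < D" using D capacity_bounds(2)[of d W, OF W] by linarith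
  define K where "K = real d * (4 / (ln 2)\<^sup>2)"
  define k where "k = card (UNIV :: 'x set)"
  define bound where "bound n = (2 * (K / (real n * \<delta>\<^sup>2) + sqrt (K / (real n * \<delta>\<^sup>2)))
     + (real n + 1) ^ k * (sqrt 2 * 2 powr (- (\<delta> * real n)))) / 2" for n
  define M where "M n = nat \<lfloor>2 powr (real n * D)\<rfloor>" for n
  \<comment> \<open>Rounding down a number that is at least 1 loses at most a factor 2; this is the
    \<open>sqrt 2\<close> in \<open>bound\<close>.\<close>
  have Mpos: "0 < M n" and M2: "2 powr (real n * D) / 2 \<le> real (M n)" for n
  proof -
    have "1 \<le> 2 powr (real n * D)" using Dpos by (intro ge_one_powr_ge_zero) auto
    hence 1: "1 \<le> \<lfloor>2 powr (real n * D)\<rfloor>" by (simp add: le_floor_iff)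
    thus "0 < M n" unfolding M_def by simp
    show "2 powr (real n * D) / 2 \<le> real (M n)" using 1 unfolding M_def by linarith
  qed
  have le: "approx_err d W n (M n) \<le> bound n" if n: "0 < n" for n
  proof -
    have "2 powr (real n * (capacity d W + 2 * \<delta>)) / real (M n) \<le> 2 powr (real n * (capacity d W + 2 * \<delta>)) / (2 powr (real n * D) / 2)"
      using M2[of n] Mpos[of n] by (intro divide_left_mono) auto
    also have "\<dots> = 2 * 2 powr (real n * (capacity d W + 2 * \<delta>) - real n * D)" by (simp add: powr_diff)
    also have "real n * (capacity d W + 2 * \<delta>) - real n * D = - (\<delta> * real n) + - (\<delta> * real n)"
      unfolding D4 by (simp add: algebra_simps)
    finally have "2 powr (real n * (capacity d W + 2 * \<delta>)) / real (M n) \<le> 2 * (2 powr (- (\<delta> * real n)))\<^sup>2"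
      unfolding powr_add power2_eq_square .
    hence "sqrt (2 powr (real n * (capacity d W + 2 * \<delta>)) / real (M n)) \<le> sqrt (2 * (2 powr (- (\<delta> * real n)))\<^sup>2)"
      by (rule real_sqrt_le_mono)
    also have "\<dots> = sqrt 2 * 2 powr (- (\<delta> * real n))" by (simp add: real_sqrt_mult)
    finally have sec: "real ((n + 1) ^ k) * sqrt (2 powr (real n * (capacity d W + 2 * \<delta>)) / real (M n))
        \<le> (real n + 1) ^ k * (sqrt 2 * 2 powr (- (\<delta> * real n)))"
      by (intro mult_mono) (auto simp: add.commute)
    show ?thesis
      by (rule order_trans[OF approx_err_bounds(2)[of d W n "M n" \<delta>, OF W n Mpos \<delta>]],
          unfold bound_def Let_def K_def[symmetric] k_def[symmetric])
        (intro divide_right_mono add_left_mono sec, simp)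
  qed
  have "(\<lambda>n. K / (real n * \<delta>\<^sup>2)) \<longlonglongrightarrow> 0" using \<delta> by real_asymp
  moreover have "(\<lambda>n. (real n + 1) ^ k * 2 powr (- (\<delta> * real n))) \<longlonglongrightarrow> 0" using \<delta> by real_asymp
  ultimately have "bound \<longlonglongrightarrow> (2 * (0 + sqrt 0) + sqrt 2 * 0) / 2"
    unfolding bound_def mult.left_commute[of _ "sqrt 2"] by (intro tendsto_intros) auto
  hence lim: "bound \<longlonglongrightarrow> 0" by simp
  have nonneg: "\<forall>\<^sub>F n in sequentially. 0 \<le> approx_err d W n (M n)"
    using eventually_gt_at_top[of 0] by eventually_elim (rule approx_err_bounds(1)[OF W _ Mpos \<delta>])
  have upper: "\<forall>\<^sub>F n in sequentially. approx_err d W n (M n) \<le> bound n"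
    using eventually_gt_at_top[of 0] by eventually_elim (rule le)
  have "(\<lambda>n. approx_err d W n (M n)) \<longlonglongrightarrow> 0"
    by (rule tendsto_sandwich[OF nonneg upper tendsto_const lim])
  thus ?thesis by (simp add: M_def)
qed

theorem theorem3:
  fixes W :: "'x::finite \<Rightarrow> complex mat" and d :: nat
  assumes "0 < d"
    and "\<And>x. density d (W x)"
  shows "sim_rate d W \<le> capacity d W"
proof (rule dense_ge)
  \<comment> \<open>Rates strictly above the capacity are used because \<open>sim_rate\<close>
    ranges over positive rates and the capacity may be 0.\<close>
  fix R assume R: "capacity d W < R"
  have "liminf (\<lambda>n. ereal (approx_err d W n (nat \<lfloor>2 powr (real n * (R + \<gamma>))\<rfloor>))) = 0" if "0 < \<gamma>" for \<gamma>
  proof -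
    have "(\<lambda>n. approx_err d W n (nat \<lfloor>2 powr (real n * (R + \<gamma>))\<rfloor>)) \<longlonglongrightarrow> 0"
      by (rule approx_err_tendsto_0[OF assms(2)]) (use R that in simp)
    hence "(\<lambda>n. ereal (approx_err d W n (nat \<lfloor>2 powr (real n * (R + \<gamma>))\<rfloor>))) \<longlonglongrightarrow> 0"
      by (simp add: zero_ereal_def)
    thus ?thesis by (intro lim_imp_Liminf) auto
  qed
  moreover have "0 < R" using R capacity_bounds(2)[of d W, OF assms(2)] by simp
  ultimately show "sim_rate d W \<le> R" unfolding sim_rate_def
    by (intro cInf_lower) (auto simp: bdd_below_def intro!: exI[of _ 0])
qed

end
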